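(* Let $P \in \Gamma(N, D_N)$ be a global holomorphic differential operator on $N=\mathbb{C}^k$ such that $P[N_m]=0$ for every $m \in \mathbb{N}$, where $N_m\in\mathbb{C}[\sigma_1,\dots,\sigma_k]$ is the $m$-th Newton polynomial. Then $P$ belongs to the left ideal $\Gamma(N,\mathcal{J})$ of $\Gamma(N, D_N)$.
   Context: Let $k$ be a positive integer and $N=\mathbb{C}^k$ with coordinates $\sigma=(\sigma_1,\dots,\sigma_k)$; write $\partial_h=\frac{\partial}{\partial\sigma_h}$, and let $[a,b]$ denote the set of integers from $a$ to $b$. $D_N$ is the sheaf of holomorphic (finite order) differential operators on $N$. For $\sigma\in N$ put $P_\sigma(z)=z^k+\sum_{h=1}^k(-1)^h\sigma_h z^{k-h}$. For $m\in\mathbb{N}$ the Newton polynomial $N_m\in\mathbb{C}[\sigma_1,\dots,\sigma_k]$ is defined by $N_m(\sigma)=\sum_{j=1}^k x_j^m$, where $x_1,\dots,x_k$ are the roots of $P_\sigma$ counted with multiplicity. $\mathcal{J}$ is the left ideal (sheaf) of $D_N$ generated by the operators $$\partial_p\partial_q-\partial_{p+i}\partial_{q-i}\quad\text{for all integers }p,q,i\text{ with }p,q,p+i,q-i\in[1,k],$$ $$\mathcal{T}^m=\partial_1\partial_{m-1}+\Big(\sum_{h=1}^k\sigma_h\partial_h\Big)\partial_m+\partial_m\quad\text{for all }m\in[2,k].$$ *)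

theory Defs
  imports "HOL-Analysis.Analysis" "HOL-Computational_Algebra.Computational_Algebra"
begin

text \<open>
  The space $N = C^k$ is \<open>complex ^ 'n\<close> with \<open>k = CARD('n)\<close>.  Its coordinates are labelled by
  \<open>1, \<dots>, k\<close> through a bijection \<open>e\<close> from \<open>{1..CARD('n)}\<close> onto \<open>'n\<close>: the coordinate
  \<open>\<sigma>\<^sub>h\<close> of \<open>\<sigma>\<close> is \<open>\<sigma> $ e h\<close>.
\<close>

text \<open>Complex Frechet differentiability at each point of \<open>U\<close>; only used for open \<open>U\<close>.\<close>

definition holo_on :: "(complex ^ 'n::finite \<Rightarrow> complex) \<Rightarrow> (complex ^ 'n) set \<Rightarrow> bool" where
  "holo_on f U \<longleftrightarrow>
     (\<forall>x\<in>U. \<exists>f'. (f has_derivative f') (at x) \<and> (\<forall>c v. f' (c *s v) = c * f' v))"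

definition pd :: "'n::finite \<Rightarrow> (complex ^ 'n \<Rightarrow> complex) \<Rightarrow> complex ^ 'n \<Rightarrow> complex" where
  "pd j f x = deriv (\<lambda>t. f (x + axis j t)) 0"

definition multi_pd ::
  "(nat \<Rightarrow> 'n::finite) \<Rightarrow> ('n \<Rightarrow> nat) \<Rightarrow> (complex ^ 'n \<Rightarrow> complex) \<Rightarrow> complex ^ 'n \<Rightarrow> complex" where
  "multi_pd e \<alpha> = foldr (\<lambda>h T. (pd (e h) ^^ \<alpha> (e h)) \<circ> T) [1..<Suc CARD('n)] id"

text \<open>
  Operators over an open set \<open>U\<close> are sections over \<open>U\<close> of the sheaf of endomorphisms of
  the sheaf \<open>O\<close> of holomorphic functions: what matters of \<open>T\<close> is the family of its actions on
  the \<open>f \<in> O(W)\<close>, read off on \<open>W\<close>, for all open \<open>W \<subseteq> U\<close>.  The values of \<open>T\<close> on all other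
  arguments are junk, and \<open>op_eq\<close> is equality of sections.  Restriction to a smaller
  open set leaves the HOL function \<open>T\<close> unchanged.
\<close>

type_synonym 'n oper = "(complex ^ 'n \<Rightarrow> complex) \<Rightarrow> complex ^ 'n \<Rightarrow> complex"

definition op_eq :: "(complex ^ 'n::finite) set \<Rightarrow> 'n oper \<Rightarrow> 'n oper \<Rightarrow> bool" where
  "op_eq U S T \<longleftrightarrow>
     (\<forall>W f. open W \<longrightarrow> W \<subseteq> U \<longrightarrow> holo_on f W \<longrightarrow> (\<forall>x\<in>W. S f x = T f x))"

definition finite_order_on :: "(nat \<Rightarrow> 'n::finite) \<Rightarrow> (complex ^ 'n) set \<Rightarrow> 'n oper \<Rightarrow> bool" where
  "finite_order_on e U T \<longleftrightarrow>
     (\<exists>d a. (\<forall>\<alpha>. holo_on (a \<alpha>) U) \<and>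
        op_eq U T (\<lambda>f x. \<Sum>\<alpha> | (\<Sum>j\<in>UNIV. \<alpha> j) \<le> (d::nat). a \<alpha> x * multi_pd e \<alpha> f x))"

text \<open>The sections over \<open>U\<close> of the sheaf of differential operators: locally of finite order.\<close>

definition diff_ops :: "(nat \<Rightarrow> 'n::finite) \<Rightarrow> (complex ^ 'n) set \<Rightarrow> 'n oper set" where
  "diff_ops e U =
     {T. \<forall>x\<in>U. \<exists>V. open V \<and> x \<in> V \<and> V \<subseteq> U \<and> finite_order_on e V T}"

definition left_ideal_gen ::
  "(nat \<Rightarrow> 'n::finite) \<Rightarrow> (complex ^ 'n) set \<Rightarrow> 'n oper set \<Rightarrow> 'n oper set" where
  "left_ideal_gen e U G =
     {T \<in> diff_ops e U. \<exists>F Q. finite F \<and> F \<subseteq> G \<and> (\<forall>g\<in>F. Q g \<in> diff_ops e U) \<and>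
        op_eq U T (\<lambda>f x. \<Sum>g\<in>F. Q g (g f) x)}"

text \<open>The sections over \<open>U\<close> of the left ideal sheaf generated by the global operators in \<open>G\<close>.\<close>

definition ideal_sheaf ::
  "(nat \<Rightarrow> 'n::finite) \<Rightarrow> 'n oper set \<Rightarrow> (complex ^ 'n) set \<Rightarrow> 'n oper set" where
  "ideal_sheaf e G U =
     {T \<in> diff_ops e U. \<forall>x\<in>U. \<exists>V. open V \<and> x \<in> V \<and> V \<subseteq> U \<and> T \<in> left_ideal_gen e V G}"

definition exchange_op :: "(nat \<Rightarrow> 'n::finite) \<Rightarrow> int \<Rightarrow> int \<Rightarrow> int \<Rightarrow> 'n oper" where
  "exchange_op e p q i f x =
     pd (e (nat p)) (pd (e (nat q)) f) x - pd (e (nat (p + i))) (pd (e (nat (q - i))) f) x"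

definition T_op :: "(nat \<Rightarrow> 'n::finite) \<Rightarrow> nat \<Rightarrow> 'n oper" where
  "T_op e m f \<sigma> =
     pd (e 1) (pd (e (m - 1)) f) \<sigma>
     + (\<Sum>h = 1..CARD('n). \<sigma> $ e h * pd (e h) (pd (e m) f) \<sigma>)
     + pd (e m) f \<sigma>"

definition J_generators :: "(nat \<Rightarrow> 'n::finite) \<Rightarrow> 'n oper set" where
  "J_generators e =
     {exchange_op e p q i | p q i. {p, q, p + i, q - i} \<subseteq> {1..int CARD('n)}}
     \<union> {T_op e m | m. m \<in> {2..CARD('n)}}"

definition J_sheaf :: "(nat \<Rightarrow> 'n::finite) \<Rightarrow> (complex ^ 'n) set \<Rightarrow> 'n oper set" where
  "J_sheaf e = ideal_sheaf e (J_generators e)"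

definition P_poly :: "(nat \<Rightarrow> 'n::finite) \<Rightarrow> complex ^ 'n \<Rightarrow> complex poly" where
  "P_poly e \<sigma> = monom 1 CARD('n)
     + (\<Sum>h = 1..CARD('n). monom ((- 1) ^ h * \<sigma> $ e h) (CARD('n) - h))"

text \<open>\<open>proots p\<close> is the multiset of the roots of \<open>p\<close>, with multiplicities.\<close>

definition newton :: "(nat \<Rightarrow> 'n::finite) \<Rightarrow> nat \<Rightarrow> complex ^ 'n \<Rightarrow> complex" where
  "newton e m \<sigma> = (\<Sum>x\<in>#proots (P_poly e \<sigma>). x ^ m)"

end

theory Submission
  imports Defs "HOL-Complex_Analysis.Cauchy_Integral_Formula"
begin

text \<open>
  Let \<open>E(t) = \<Sum>\<^sub>h (-1)\<^sup>h \<sigma>\<^sub>h t\<^sup>h\<close> with \<open>\<sigma>\<^sub>0 = 1\<close> and \<open>G = 1/E\<close>.  Taking logarithmic derivatives,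
  \<open>\<Sum>\<^sub>m N\<^sub>m t\<^sup>m = k - t E' G\<close>, and from this one finds a closed formula for all derivatives of the Newton
  polynomials: if \<open>w\<close> is a non-empty product of \<open>r\<close> partial derivatives whose labels add up to the
  weight \<open>s\<close>, then \<open>w[N\<^sub>m]\<close> is \<open>(-1)\<^sup>r\<^sup>+\<^sup>s (r - 1)! m\<close> times the coefficient of \<open>t\<^sup>m\<^sup>-\<^sup>s\<close> in \<open>G\<^sup>r\<close>
  (\<open>word_pd_newton\<close>).  The formula depends on \<open>r\<close> and \<open>s\<close> only, and \<open>E G\<^sup>2 = G\<close>; so all generators of
  the ideal annihilate all \<open>N\<^sub>m\<close> (\<open>generator_newton\<close>).

  Conversely, work modulo the ideal.  The exchange operators identify any two products of partial
  derivatives with the same order and weight (\<open>word_equiv_same_weight\<close>).  The products of the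
  remaining generators with partial derivatives express a product of order \<open>r \<ge> 2\<close> and weight at most
  \<open>(r - 1) k\<close> through products of the same order and larger weight and products of smaller order
  (\<open>in_ideal_T_op\<close>).  What remains in order \<open>r\<close> are the weights \<open>(r - 1) k + 1, \<dots>, r k\<close>, so there is
  one normal form for each weight \<open>n\<close>, including \<open>n = 0\<close> for the identity, and every operator of
  finite order is congruent to a combination of normal forms with holomorphic coefficients
  (\<open>reducible_word_pd\<close>).

  By the closed formula the normal form of weight \<open>n\<close> annihilates \<open>N\<^sub>m\<close> for \<open>m < n\<close> and maps \<open>N\<^sub>n\<close>
  to a function without zeros, because \<open>G\<close> has constant term \<open>1\<close>.  If an operator annihilates all \<open>N\<^sub>m\<close>, then so does its
  combination of normal forms, and this triangular system, solved at each point separately, shows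
  that all coefficients are zero (\<open>in_ideal_if_kills_newton\<close>).

  The manipulation of operators rests on two facts about functions of several complex variables:
  partial derivatives of holomorphic functions are holomorphic, and they commute (\<open>pd_holo\<close>).
\<close>

(* The sign $ is reserved for vector components, so that formulas about points parse uniquely. *)
unbundle no fps_syntax

section \<open>Holomorphic functions of several variables\<close>

lemma bounded_linear_axis: "bounded_linear (axis j :: complex \<Rightarrow> complex ^ 'n::finite)"
proof (intro bounded_linearI')
  show "axis j (x + y) = axis j x + (axis j y :: complex ^ 'n)" for x y
    by (simp add: axis_def vec_eq_iff)
  show "axis j (c *\<^sub>R x) = c *\<^sub>R (axis j x :: complex ^ 'n)" for c x
    by (simp add: axis_def vec_eq_iff)
qed

lemma pd_cong:
  fixes f g :: "complex ^ 'n::finite \<Rightarrow> complex"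
  assumes "open W" "x \<in> W" "\<And>y. y \<in> W \<Longrightarrow> f y = g y"
  shows "pd j f x = pd j g x"
  unfolding pd_def
proof (rule deriv_cong_ev)
  have "((\<lambda>t. x + axis j t) \<longlongrightarrow> x + axis j 0) (nhds 0)"
    by (intro tendsto_intros bounded_linear.tendsto[OF bounded_linear_axis] filterlim_ident)
  moreover have "axis j 0 = (0 :: complex ^ 'n)" by (simp add: axis_def vec_eq_iff)
  ultimately have "((\<lambda>t. x + axis j t) \<longlongrightarrow> x) (nhds 0)" by simp
  from topological_tendstoD[OF this assms(1,2)]
  show "\<forall>\<^sub>F t in nhds 0. f (x + axis j t) = g (x + axis j t)"
    by (rule eventually_mono) (use assms(3) in auto)
qed auto

text \<open>
  A complex-linear map is determined by its values on the axes, so a derivative written as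
  \<open>\<Sum>\<^sub>j v\<^sub>j D\<^sub>j\<close> exhibits the partial derivatives as its coefficients.  The second conclusion keeps
  the one-variable differentiability that \<open>deriv\<close> forgets.
\<close>

lemma pd_eqI:
  fixes f :: "complex ^ 'n::finite \<Rightarrow> complex"
  assumes "(f has_derivative (\<lambda>v. \<Sum>j\<in>UNIV. v $ j * D j)) (at x)"
  shows "pd j f x = D j" "((\<lambda>t. f (x + axis j t)) has_field_derivative D j) (at 0)"
proof -
  have ax0: "axis j 0 = (0 :: complex ^ 'n)" by (simp add: axis_def vec_eq_iff)
  have "((\<lambda>t. x + axis j t) has_derivative (\<lambda>t. 0 + axis j t)) (at 0)"
    by (intro derivative_intros bounded_linear.has_derivative[OF bounded_linear_axis])
  moreover have "(f has_derivative (\<lambda>v. \<Sum>j\<in>UNIV. v $ j * D j)) (at (x + axis j 0))"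
    using assms by (simp add: ax0)
  ultimately have "((\<lambda>t. f (x + axis j t)) has_derivative
      (\<lambda>t. \<Sum>l\<in>UNIV. (0 + axis j t :: complex ^ 'n) $ l * D l)) (at 0)"
    by (rule has_derivative_compose)
  also have "(\<lambda>t. \<Sum>l\<in>UNIV. (0 + axis j t :: complex ^ 'n) $ l * D l) = (*) (D j)"
    by (auto simp: axis_def fun_eq_iff if_distrib[of "\<lambda>z. z * _"] sum.delta cong: if_cong)
  finally show *: "((\<lambda>t. f (x + axis j t)) has_field_derivative D j) (at 0)"
    by (simp add: has_field_derivative_def)
  then show "pd j f x = D j" unfolding pd_def by (rule DERIV_imp_deriv)
qed

lemma holo_onI:
  assumes "\<And>x. x \<in> W \<Longrightarrow> (f has_derivative (\<lambda>v. \<Sum>j\<in>UNIV. v $ j * D j x)) (at x)"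
  shows "holo_on f W"
  unfolding holo_on_def
proof (intro ballI exI conjI allI)
  fix x assume "x \<in> W"
  then show "(f has_derivative (\<lambda>v. \<Sum>j\<in>UNIV. v $ j * D j x)) (at x)" by (rule assms)
qed (simp add: sum_distrib_left mult.assoc)

lemma holo_on_has_derivative:
  assumes "holo_on f W" "x \<in> W"
  shows "(f has_derivative (\<lambda>v. \<Sum>j\<in>UNIV. v $ j * pd j f x)) (at x)"
proof -
  obtain f' where f': "(f has_derivative f') (at x)" and lin: "\<And>c v. f' (c *s v) = c * f' v"
    using assms unfolding holo_on_def by blast
  interpret bounded_linear f' using f' by (rule has_derivative_bounded_linear)
  have eq: "f' = (\<lambda>v. \<Sum>j\<in>UNIV. v $ j * f' (axis j 1))"
  proof
    fix v :: "complex ^ 'a"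
    have "f' v = f' (\<Sum>j\<in>UNIV. v $ j *s axis j 1)" by (simp add: basis_expansion)
    also have "\<dots> = (\<Sum>j\<in>UNIV. v $ j * f' (axis j 1))" by (simp add: sum lin)
    finally show "f' v = (\<Sum>j\<in>UNIV. v $ j * f' (axis j 1))" .
  qed
  then have d: "(f has_derivative (\<lambda>v. \<Sum>j\<in>UNIV. v $ j * f' (axis j 1))) (at x)"
    using f' by simp
  then have "pd j f x = f' (axis j 1)" for j by (rule pd_eqI)
  then show ?thesis using d by simp
qed

lemma holo_on_subset: "holo_on f W \<Longrightarrow> V \<subseteq> W \<Longrightarrow> holo_on f V"
  unfolding holo_on_def by blast

lemma holo_on_continuous: "holo_on f W \<Longrightarrow> continuous_on W f"
  by (rule continuous_at_imp_continuous_on)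
     (blast intro: has_derivative_continuous holo_on_has_derivative)

lemma holo_on_const: "holo_on (\<lambda>x. c) W" and pd_const: "pd j (\<lambda>x. c) = (\<lambda>x. 0)"
proof -
  have d: "((\<lambda>x. c) has_derivative (\<lambda>v. \<Sum>j\<in>UNIV. v $ j * 0)) (at x)" for x :: "complex ^ 'b"
    by simp
  then show "pd j (\<lambda>x. c) = (\<lambda>x. 0)" by (intro ext pd_eqI(1))
  show "holo_on (\<lambda>x. c) W"
    by (rule holo_onI[where D = "\<lambda>j x. 0"]) simp
qed

lemma coord_has_derivative:
  "((\<lambda>x :: complex ^ 'n::finite. x $ l) has_derivative
     (\<lambda>v. \<Sum>j\<in>UNIV. v $ j * (if j = l then 1 else 0))) (at x)"
proof -
  have "((\<lambda>x :: complex ^ 'n::finite. x $ l) has_derivative (\<lambda>v. v $ l)) (at x)"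
    by (intro bounded_linear_imp_has_derivative bounded_linear_vec_nth)
  then show ?thesis by (simp add: if_distrib cong: if_cong)
qed

lemma holo_on_coord: "holo_on (\<lambda>x. x $ l) W"
  by (rule holo_onI[where D = "\<lambda>j x. if j = l then 1 else 0"]) (rule coord_has_derivative)

lemma pd_coord: "pd j (\<lambda>x. x $ l) = (\<lambda>x. if j = l then 1 else 0)"
  by (intro ext pd_eqI(1)) (rule coord_has_derivative)

lemma add_has_derivative:
  assumes "holo_on f W" "holo_on g W" "x \<in> W"
  shows "((\<lambda>x. f x + g x) has_derivative
           (\<lambda>v. \<Sum>j\<in>UNIV. v $ j * (pd j f x + pd j g x))) (at x)"
  using has_derivative_add[OF holo_on_has_derivative[OF assms(1,3)] holo_on_has_derivative[OF assms(2,3)]]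
  by (simp add: sum.distrib distrib_left)

lemma mult_has_derivative:
  assumes "holo_on f W" "holo_on g W" "x \<in> W"
  shows "((\<lambda>x. f x * g x) has_derivative
           (\<lambda>v. \<Sum>j\<in>UNIV. v $ j * (pd j f x * g x + f x * pd j g x))) (at x)"
  using has_derivative_mult[OF holo_on_has_derivative[OF assms(1,3)] holo_on_has_derivative[OF assms(2,3)]]
  by (simp add: sum.distrib distrib_left sum_distrib_left sum_distrib_right mult_ac add.commute)

lemma holo_on_add: "holo_on f W \<Longrightarrow> holo_on g W \<Longrightarrow> holo_on (\<lambda>x. f x + g x) W"
  by (rule holo_onI) (rule add_has_derivative)

lemma holo_on_mult: "holo_on f W \<Longrightarrow> holo_on g W \<Longrightarrow> holo_on (\<lambda>x. f x * g x) W"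
  by (rule holo_onI) (rule mult_has_derivative)

lemma pd_add:
  "holo_on f W \<Longrightarrow> holo_on g W \<Longrightarrow> x \<in> W \<Longrightarrow> pd j (\<lambda>x. f x + g x) x = pd j f x + pd j g x"
  by (rule pd_eqI(1)) (rule add_has_derivative)

lemma pd_mult:
  "holo_on f W \<Longrightarrow> holo_on g W \<Longrightarrow> x \<in> W \<Longrightarrow>
     pd j (\<lambda>x. f x * g x) x = pd j f x * g x + f x * pd j g x"
  by (rule pd_eqI(1)) (rule mult_has_derivative)

lemma holo_on_sum:
  "(\<And>i. i \<in> A \<Longrightarrow> holo_on (f i) W) \<Longrightarrow> holo_on (\<lambda>x. \<Sum>i\<in>A. f i x) W"
  by (induction A rule: infinite_finite_induct) (auto intro: holo_on_const holo_on_add)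

lemma pd_sum:
  "(\<And>i. i \<in> A \<Longrightarrow> holo_on (f i) W) \<Longrightarrow> x \<in> W \<Longrightarrow>
     pd j (\<lambda>x. \<Sum>i\<in>A. f i x) x = (\<Sum>i\<in>A. pd j (f i) x)"
proof (induction A rule: infinite_finite_induct)
  case (insert a A)
  then show ?case by (simp add: pd_add[where W = W] holo_on_sum)
qed (simp_all add: pd_const)

lemma norm_axis: "norm (axis j t :: complex ^ 'n::finite) = norm t"
  by (simp add: axis_def norm_vec_def L2_set_def if_distrib[of "\<lambda>z. (norm z)\<^sup>2"] cong: if_cong)

text \<open>
  The circle of radius \<open>R\<close> about \<open>0\<close>, parametrised by \<open>[0, 1]\<close> so that contour integrals
  become integrals over a fixed box.
\<close>

definition circ :: "real \<Rightarrow> real \<Rightarrow> complex" where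
  "circ R t = of_real R * exp (2 * of_real pi * \<i> * of_real t)"

lemma norm_circ: "R \<ge> 0 \<Longrightarrow> norm (circ R t) = R"
  by (simp add: circ_def norm_mult)

lemma continuous_on_circ [continuous_intros]:
  "continuous_on A g \<Longrightarrow> continuous_on A (\<lambda>t. circ R (g t))"
  unfolding circ_def by (intro continuous_intros)

lemma circlepath_circ: "circlepath 0 R t = circ R t"
  by (simp add: circlepath circ_def)

text \<open>
  Cauchy's formula for the first derivative along one coordinate axis.  With \<open>\<zeta> = circ R t\<close> one has
  \<open>d\<zeta> = 2\<pi>i \<zeta> dt\<close>, which cancels one of the two factors in \<open>1/\<zeta>\<^sup>2\<close> and the factor \<open>1/(2\<pi>i)\<close>.
\<close>

lemma pd_cauchy:
  assumes f: "holo_on f W" and R: "R > 0" and sub: "cball x R \<subseteq> W"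
  shows "((\<lambda>t. f (x + axis j (circ R t)) / circ R t) has_integral pd j f x) (cbox 0 1)"
proof -
  define h where "h = (\<lambda>t. f (x + axis j t))"
  have hd: "h field_differentiable (at t)" if "t \<in> cball 0 R" for t
  proof -
    have "x + axis j t \<in> W" using that sub by (auto simp: norm_axis dist_norm subset_eq)
    from pd_eqI(2)[OF holo_on_has_derivative[OF f this], of j]
    have "((\<lambda>s. h (s + t)) has_field_derivative pd j f (x + axis j t)) (at 0)"
      by (simp add: h_def bounded_linear_axis[THEN bounded_linear.linear, THEN linear_add] add_ac)
    from iffD2[OF DERIV_shift this] show ?thesis
      by (auto simp: field_differentiable_def)
  qed
  have "h holomorphic_on cball 0 R"
    using hd by (auto simp: holomorphic_on_def intro: field_differentiable_at_within)
  then have "((\<lambda>u. h u / (u - 0) ^ Suc 1) has_contour_integral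
      ((2 * pi * \<i>) / (fact 1) * (deriv ^^ 1) h 0)) (circlepath 0 R)"
    using R by (intro Cauchy_has_contour_integral_higher_derivative_circlepath)
       (auto intro: holomorphic_on_imp_continuous_on elim: holomorphic_on_subset)
  then have "((\<lambda>t. h (circ R t) / (circ R t) ^ 2 * (2 * pi * \<i> * circ R t)) has_integral
      2 * pi * \<i> * pd j f x) {0..1}"
    unfolding has_contour_integral_def
    by (rule has_integral_eq_rhs[OF has_integral_eq, rotated])
       (auto simp: vector_derivative_circlepath01 circlepath_circ pd_def h_def power2_eq_square circ_def)
  from has_integral_mult_left[OF this, of "1 / (2 * pi * \<i>)"]
  show ?thesis
    using R by (simp add: h_def circ_def power2_eq_square field_simps)
qed

text \<open>
  Cauchy's formula writes \<open>pd j f\<close> near a point as an integral of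
  translates of \<open>f\<close>; this first shows that all partial derivatives are continuous, and continuity
  is what differentiation under the integral sign needs.  The resulting formula for \<open>pd l (pd j f)\<close>
  is Cauchy's formula for \<open>pd j (pd l f)\<close>, whence the symmetry of second derivatives.
\<close>

lemma pd_holo:
  assumes W: "open W" and f: "holo_on f W"
  shows "holo_on (pd j f) W" and "x \<in> W \<Longrightarrow> pd l (pd j f) x = pd j (pd l f) x"
proof -
  have in_W: "y + axis j (circ R t) \<in> W"
    if "R > 0" "y \<in> ball x R" "cball x (2 * R) \<subseteq> W" for x y :: "complex ^ 'a" and R t j
  proof -
    have "dist x (y + axis j (circ R t)) \<le> dist x y + norm (axis j (circ R t) :: complex ^ 'a)"
      by (metis dist_triangle dist_add_cancel add.right_neutral dist_0_norm)
    also have "\<dots> \<le> 2 * R" using that by (simp add: norm_axis norm_circ)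
    finally show ?thesis using that by auto
  qed
  have sub: "cball y R \<subseteq> W"
    if "R > 0" "y \<in> ball x R" "cball x (2 * R) \<subseteq> W" for x y :: "complex ^ 'a" and R
  proof
    fix z assume "z \<in> cball y R"
    then have "dist x z \<le> 2 * R" using that dist_triangle[of x z y] by auto
    then show "z \<in> W" using that by auto
  qed
  have radius: "\<exists>R>0. cball x (2 * R) \<subseteq> W" if "x \<in> W" for x
  proof -
    from W that obtain r where "r > 0" "cball x r \<subseteq> W"
      using open_contains_cball_eq[of W] by auto
    then have "r / 2 > 0 \<and> cball x (2 * (r / 2)) \<subseteq> W" by simp
    then show ?thesis by (rule exI)
  qed
  have cont_shift: "continuous_on (ball x R \<times> cbox 0 1) (\<lambda>(y, t). g (y + axis j (circ R t)) / circ R t)"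
    if "R > 0" "cball x (2 * R) \<subseteq> W" "continuous_on W g"
    for x R and j and g :: "complex ^ 'a \<Rightarrow> complex"
  proof -
    have "circ R t \<noteq> 0" for t using that(1) by (simp add: circ_def)
    then show ?thesis
      unfolding split_beta using that(1)
      by (intro continuous_intros continuous_on_compose2[OF that(3)]
            bounded_linear.continuous_on[OF bounded_linear_axis])
         (use in_W[OF that(1) _ that(2)] in auto)
  qed
  \<comment> \<open>Every partial derivative is locally a parameter integral of a jointly continuous function.\<close>
  have cont: "continuous_on W (pd j f)" for j
  proof (rule continuous_at_imp_continuous_on, rule ballI)
    fix x assume "x \<in> W"
    from radius[OF this] obtain R where R: "R > 0" "cball x (2 * R) \<subseteq> W" by blast
    have "continuous_on (ball x R)
        (\<lambda>y. integral (cbox 0 1) (\<lambda>t. f (y + axis j (circ R t)) / circ R t))"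
      by (rule integral_continuous_on_param) (intro cont_shift R holo_on_continuous[OF f])
    then have "continuous_on (ball x R) (pd j f)"
    proof (rule continuous_on_eq)
      fix y assume "y \<in> ball x R"
      from pd_cauchy[OF f R(1) sub[OF R(1) this R(2)]]
      show "integral (cbox 0 1) (\<lambda>t. f (y + axis j (circ R t)) / circ R t) = pd j f y"
        by (rule integral_unique)
    qed
    then show "isCont (pd j f) x"
      using R(1) by (simp add: continuous_on_eq_continuous_at)
  qed
  \<comment> \<open>Differentiation under the integral sign; \<open>F y t\<close> is the derivative of the integrand at \<open>y\<close>.\<close>
  have main: "(pd j f has_derivative (\<lambda>v. \<Sum>l\<in>UNIV. v $ l *
       integral (cbox 0 1) (\<lambda>t. pd l f (x + axis j (circ R t)) / circ R t))) (at x)"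
    if xW: "x \<in> W" and R: "R > 0" "cball x (2 * R) \<subseteq> W" for x j R
  proof -
    define F where "F = (\<lambda>y t. Blinfun (\<lambda>v. \<Sum>l\<in>UNIV. v $ l * (pd l f (y + axis j (circ R t)) / circ R t)))"
    have bl: "bounded_linear (\<lambda>v :: complex ^ 'a. \<Sum>l\<in>UNIV. v $ l * c l)" for c
      by (intro bounded_linear_sum bounded_linear_mult_const bounded_linear_vec_nth)
    have F: "blinfun_apply (F y t) = (\<lambda>v. \<Sum>l\<in>UNIV. v $ l * (pd l f (y + axis j (circ R t)) / circ R t))" for y t
      unfolding F_def by (rule bounded_linear_Blinfun_apply) (rule bl)
    have contF: "continuous_on (ball x R \<times> cbox 0 1) (\<lambda>(y, t). F y t)"
    proof (rule continuous_on_blinfun_componentwise)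
      fix v :: "complex ^ 'a"
      have "continuous_on (ball x R \<times> cbox 0 1)
          (\<lambda>z. \<Sum>l\<in>UNIV. v $ l * ((\<lambda>(y, t). pd l f (y + axis j (circ R t)) / circ R t) z))"
        by (intro continuous_intros cont_shift R cont)
      then show "continuous_on (ball x R \<times> cbox 0 1) (\<lambda>z. blinfun_apply (case z of (y, t) \<Rightarrow> F y t) v)"
        by (simp add: split_beta F)
    qed
    have "((\<lambda>y. integral (cbox 0 1) (\<lambda>t. f (y + axis j (circ R t)) / circ R t)) has_derivative
        integral (cbox 0 1) (F x)) (at x within ball x R)"
    proof (rule leibniz_rule)
      fix y t assume y: "y \<in> ball x R" and t: "t \<in> cbox 0 (1 :: real)"
      have "((\<lambda>y. y + axis j (circ R t)) has_derivative (\<lambda>v. v)) (at y)"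
        by (auto intro!: derivative_eq_intros)
      from has_derivative_compose[OF this holo_on_has_derivative[OF f in_W[OF R(1) y R(2)]]]
      have "((\<lambda>y. f (y + axis j (circ R t))) has_derivative
         (\<lambda>v. \<Sum>l\<in>UNIV. v $ l * pd l f (y + axis j (circ R t)))) (at y)" .
      from has_derivative_mult_left[OF this, of "inverse (circ R t)"]
      have "((\<lambda>y. f (y + axis j (circ R t)) / circ R t) has_derivative blinfun_apply (F y t)) (at y)"
        by (simp add: F divide_inverse sum_distrib_right mult.assoc)
      then show "((\<lambda>y. f (y + axis j (circ R t)) / circ R t) has_derivative blinfun_apply (F y t))
          (at y within ball x R)"
        by (rule has_derivative_at_withinI)
    next
      fix y assume "y \<in> ball x R"
      from pd_cauchy[OF f R(1) sub[OF R(1) this R(2)]]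
      show "(\<lambda>t. f (y + axis j (circ R t)) / circ R t) integrable_on cbox 0 1" by blast
    qed (use R contF in auto)
    then have "(pd j f has_derivative integral (cbox 0 1) (F x)) (at x within ball x R)"
    proof (rule has_derivative_transform[rotated 2])
      fix y assume "y \<in> ball x R"
      from pd_cauchy[OF f R(1) sub[OF R(1) this R(2)]]
      show "pd j f y = integral (cbox 0 1) (\<lambda>t. f (y + axis j (circ R t)) / circ R t)"
        by (metis integral_unique)
    qed (use R in auto)
    then have "(pd j f has_derivative integral (cbox 0 1) (F x)) (at x)"
      using R(1) by (simp add: at_within_open[of x "ball x R"])
    moreover have "blinfun_apply (integral (cbox 0 1) (F x)) v =
        (\<Sum>l\<in>UNIV. v $ l * integral (cbox 0 1) (\<lambda>t. pd l f (x + axis j (circ R t)) / circ R t))" for v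
    proof -
      have slice: "continuous_on (cbox 0 1) (\<lambda>t. G (x, t))"
        if "continuous_on (ball x R \<times> cbox 0 1) G"
        for G :: "(complex ^ 'a) \<times> real \<Rightarrow> 'c::topological_space"
        by (rule continuous_on_compose2[OF that]) (use R in \<open>auto intro!: continuous_intros\<close>)
      have int: "(\<lambda>t. pd l f (x + axis j (circ R t)) / circ R t) integrable_on cbox 0 1" for l
        by (rule integrable_continuous) (use slice[OF cont_shift[OF R cont]] in simp)
      have "F x integrable_on cbox 0 1"
        by (rule integrable_continuous) (use slice[OF contF] in simp)
      then have "blinfun_apply (integral (cbox 0 1) (F x)) v =
          integral (cbox 0 1) (\<lambda>t. \<Sum>l\<in>UNIV. v $ l * (pd l f (x + axis j (circ R t)) / circ R t))"
        by (simp add: blinfun_apply_integral F)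
      also have "\<dots> = (\<Sum>l\<in>UNIV. integral (cbox 0 1) (\<lambda>t. v $ l * (pd l f (x + axis j (circ R t)) / circ R t)))"
        by (intro integral_sum integrable_on_mult_right int) simp
      finally show ?thesis by (simp only: integral_mult_right)
    qed
    ultimately show ?thesis by (metis (no_types, lifting) ext)
  qed
  have holo: "holo_on (pd j f) W" for j
    unfolding holo_on_def
  proof (intro ballI)
    fix x assume x: "x \<in> W"
    from radius[OF this] obtain R where R: "R > 0" "cball x (2 * R) \<subseteq> W" by blast
    show "\<exists>f'. (pd j f has_derivative f') (at x) \<and> (\<forall>c v. f' (c *s v) = c * f' v)"
      by (intro exI conjI, rule main[OF x R]) (simp add: sum_distrib_left mult.assoc)
  qed
  then show "holo_on (pd j f) W" .
  show "pd l (pd j f) x = pd j (pd l f) x" if x: "x \<in> W"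
  proof -
    from radius[OF x] obtain R where R: "R > 0" "cball x (2 * R) \<subseteq> W" by blast
    have "pd l (pd j f) x = integral (cbox 0 1) (\<lambda>t. pd l f (x + axis j (circ R t)) / circ R t)"
      by (rule pd_eqI(1)[OF main[OF x R]])
    also have "\<dots> = pd j (pd l f) x"
      by (rule integral_unique, rule pd_cauchy[OF holo R(1) sub]) (use R in auto)
    finally show ?thesis .
  qed
qed

section \<open>Iterated partial derivatives\<close>

text \<open>
  A word \<open>[h\<^sub>1, \<dots>, h\<^sub>r]\<close> of coordinate labels stands for \<open>\<partial>\<^sub>h\<^sub>1 \<dots> \<partial>\<^sub>h\<^sub>r\<close>.  Its length is the
  order of the operator and its sum is called the weight.  Words, unlike multi-indices, let one
  insert or replace single derivations.
\<close>

primrec word_pd :: "(nat \<Rightarrow> 'n::finite) \<Rightarrow> nat list \<Rightarrow> 'n oper" where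
  "word_pd e [] f = f"
| "word_pd e (h # w) f = pd (e h) (word_pd e w f)"

lemma word_pd_append: "word_pd e (u @ v) f = word_pd e u (word_pd e v f)"
  by (induction u) simp_all

lemma word_pd_holo: "open W \<Longrightarrow> holo_on f W \<Longrightarrow> holo_on (word_pd e w f) W"
  by (induction w) (simp_all add: pd_holo(1))

lemma word_pd_cong:
  assumes "open W" "\<And>y. y \<in> W \<Longrightarrow> f y = g y"
  shows "x \<in> W \<Longrightarrow> word_pd e w f x = word_pd e w g x"
  by (induction w arbitrary: x) (use assms in \<open>auto intro: pd_cong[of W]\<close>)

lemma word_pd_add:
  assumes "open W" "holo_on f W" "holo_on g W"
  shows "x \<in> W \<Longrightarrow> word_pd e w (\<lambda>y. f y + g y) x = word_pd e w f x + word_pd e w g x"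
proof (induction w arbitrary: x)
  case (Cons h w)
  then have "pd (e h) (word_pd e w (\<lambda>y. f y + g y)) x
      = pd (e h) (\<lambda>y. word_pd e w f y + word_pd e w g y) x"
    by (intro pd_cong[of W]) (use assms in auto)
  then show ?case using Cons assms by (simp add: pd_add[where W = W] word_pd_holo)
qed simp

lemma pd_cmult:
  assumes "holo_on f W" "x \<in> W"
  shows "pd j (\<lambda>y. c * f y) x = c * pd j f x"
  using pd_mult[OF holo_on_const assms(1,2), of j c] by (simp add: pd_const)

lemma word_pd_diff:
  assumes "open W" "holo_on f W" "holo_on g W"
  shows "x \<in> W \<Longrightarrow> word_pd e w (\<lambda>y. f y - g y) x = word_pd e w f x - word_pd e w g x"
proof (induction w arbitrary: x)
  case (Cons h w)
  then have "pd (e h) (word_pd e w (\<lambda>y. f y - g y)) x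
      = pd (e h) (\<lambda>y. word_pd e w f y + (- 1) * word_pd e w g y) x"
    by (intro pd_cong[of W]) (use assms in auto)
  also have "\<dots> = pd (e h) (word_pd e w f) x + pd (e h) (\<lambda>y. (- 1) * word_pd e w g y) x"
    using Cons assms by (intro pd_add[where W = W] word_pd_holo holo_on_mult holo_on_const) auto
  also have "\<dots> = pd (e h) (word_pd e w f) x - pd (e h) (word_pd e w g) x"
    using Cons assms pd_cmult[OF word_pd_holo[OF assms(1,3), of e w] Cons.prems, of "e h" "- 1"] by simp
  finally show ?case by simp
qed simp

lemma word_pd_zero: "word_pd e w (\<lambda>y. 0) = (\<lambda>y. 0)"
  by (induction w) (simp_all add: pd_const)

lemma pd_word_pd_commute:
  assumes "open W" "holo_on f W"
  shows "x \<in> W \<Longrightarrow> word_pd e w (pd j f) x = pd j (word_pd e w f) x"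
proof (induction w arbitrary: x)
  case (Cons h w)
  then have "pd (e h) (word_pd e w (pd j f)) x = pd (e h) (pd j (word_pd e w f)) x"
    by (intro pd_cong[of W]) (use assms in auto)
  also have "\<dots> = pd j (pd (e h) (word_pd e w f)) x"
    using Cons assms by (intro pd_holo(2)[of W] word_pd_holo) auto
  finally show ?case by simp
qed simp

text \<open>
  Partial derivatives commute on holomorphic functions, so only the multiset of letters matters.
\<close>

lemma word_pd_mset:
  assumes "open W" "holo_on f W"
  shows "mset u = mset v \<Longrightarrow> x \<in> W \<Longrightarrow> word_pd e u f x = word_pd e v f x"
proof (induction u arbitrary: v x)
  case (Cons a u)
  then have "a \<in> set v" by (metis list.set_intros(1) set_mset_mset)
  then obtain v1 v2 where v: "v = v1 @ a # v2" by (meson split_list)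
  with Cons.prems have u: "mset u = mset (v1 @ v2)" by simp
  have "word_pd e (a # u) f x = pd (e a) (word_pd e (v1 @ v2) f) x"
    unfolding word_pd.simps by (intro pd_cong[of W] assms Cons.IH u Cons.prems)
  also have "\<dots> = word_pd e v1 (pd (e a) (word_pd e v2 f)) x"
    unfolding word_pd_append using assms Cons.prems
    by (intro pd_word_pd_commute[of W, symmetric] word_pd_holo)
  finally show ?case by (simp add: v word_pd_append)
qed simp

abbreviation letters :: "nat \<Rightarrow> nat list \<Rightarrow> bool" where
  "letters k w \<equiv> set w \<subseteq> {1..k}"

locale labelled_coords =
  fixes e :: "nat \<Rightarrow> 'n::finite"
  assumes bij: "bij_betw e {1..CARD('n)} UNIV"
begin

lemma e_eq_iff: "h \<in> {1..CARD('n)} \<Longrightarrow> l \<in> {1..CARD('n)} \<Longrightarrow> e h = e l \<longleftrightarrow> h = l"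
  by (rule inj_on_eq_iff[OF bij_betw_imp_inj_on[OF bij]])

end

section \<open>Power series with holomorphic coefficients\<close>

definition holo_fps :: "(complex ^ 'n::finite \<Rightarrow> complex fps) \<Rightarrow> bool" where
  "holo_fps F \<longleftrightarrow> (\<forall>n. holo_on (\<lambda>\<sigma>. fps_nth (F \<sigma>) n) UNIV)"

definition pd_fps :: "'n::finite \<Rightarrow> (complex ^ 'n \<Rightarrow> complex fps) \<Rightarrow> complex ^ 'n \<Rightarrow> complex fps" where
  "pd_fps j F \<sigma> = Abs_fps (\<lambda>n. pd j (\<lambda>\<tau>. fps_nth (F \<tau>) n) \<sigma>)"

lemma holo_fps_mult: "holo_fps F \<Longrightarrow> holo_fps H \<Longrightarrow> holo_fps (\<lambda>\<sigma>. F \<sigma> * H \<sigma>)"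
  unfolding holo_fps_def fps_mult_nth by (intro allI holo_on_sum holo_on_mult) simp_all

lemma holo_fps_const: "holo_fps (\<lambda>\<sigma>. c)"
  by (simp add: holo_fps_def holo_on_const)

lemma holo_fps_power: "holo_fps F \<Longrightarrow> holo_fps (\<lambda>\<sigma>. F \<sigma> ^ r)"
  by (induction r) (simp_all add: holo_fps_const holo_fps_mult)

lemma holo_fps_deriv: "holo_fps F \<Longrightarrow> holo_fps (\<lambda>\<sigma>. fps_deriv (F \<sigma>))"
  unfolding holo_fps_def fps_deriv_nth by (auto intro: holo_on_mult holo_on_const)

lemma pd_fps_mult:
  assumes "holo_fps F" "holo_fps H"
  shows "pd_fps j (\<lambda>\<sigma>. F \<sigma> * H \<sigma>) \<sigma> = pd_fps j F \<sigma> * H \<sigma> + F \<sigma> * pd_fps j H \<sigma>"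
proof (rule fps_ext)
  fix n
  have "fps_nth (pd_fps j (\<lambda>\<sigma>. F \<sigma> * H \<sigma>) \<sigma>) n
      = (\<Sum>i=0..n. pd j (\<lambda>\<sigma>. fps_nth (F \<sigma>) i * fps_nth (H \<sigma>) (n - i)) \<sigma>)"
    unfolding pd_fps_def fps_mult_nth fps_nth_Abs_fps
    by (rule pd_sum[where W = UNIV]) (use assms in \<open>auto simp: holo_fps_def intro: holo_on_mult\<close>)
  also have "\<dots> = (\<Sum>i=0..n. pd j (\<lambda>\<sigma>. fps_nth (F \<sigma>) i) \<sigma> * fps_nth (H \<sigma>) (n - i)
      + fps_nth (F \<sigma>) i * pd j (\<lambda>\<sigma>. fps_nth (H \<sigma>) (n - i)) \<sigma>)"
    by (intro sum.cong refl pd_mult[where W = UNIV]) (use assms in \<open>auto simp: holo_fps_def\<close>)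
  also have "\<dots> = fps_nth (pd_fps j F \<sigma> * H \<sigma> + F \<sigma> * pd_fps j H \<sigma>) n"
    by (simp add: pd_fps_def fps_mult_nth sum.distrib)
  finally show "fps_nth (pd_fps j (\<lambda>\<sigma>. F \<sigma> * H \<sigma>) \<sigma>) n = \<dots>" .
qed

lemma pd_fps_const: "pd_fps j (\<lambda>\<sigma>. c) \<sigma> = 0"
  by (rule fps_ext) (simp add: pd_fps_def pd_const)

lemma pd_fps_deriv:
  assumes "holo_fps F"
  shows "pd_fps j (\<lambda>\<sigma>. fps_deriv (F \<sigma>)) \<sigma> = fps_deriv (pd_fps j F \<sigma>)"
  by (rule fps_ext)
     (use assms in \<open>simp add: pd_fps_def holo_fps_def pd_cmult[where W = UNIV]\<close>)

lemma pd_fps_power: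
  assumes "holo_fps F"
  shows "pd_fps j (\<lambda>\<sigma>. F \<sigma> ^ Suc r) \<sigma> = of_nat (Suc r) * F \<sigma> ^ r * pd_fps j F \<sigma>"
proof (induction r)
  case (Suc r)
  have "pd_fps j (\<lambda>\<sigma>. F \<sigma> * F \<sigma> ^ Suc r) \<sigma>
      = pd_fps j F \<sigma> * F \<sigma> ^ Suc r + F \<sigma> * pd_fps j (\<lambda>\<sigma>. F \<sigma> ^ Suc r) \<sigma>"
    by (rule pd_fps_mult) (intro assms holo_fps_power)+
  then show ?case unfolding Suc.IH by (simp add: algebra_simps)
qed simp

section \<open>Derivatives of the Newton polynomials\<close>

text \<open>
  The logarithmic derivative of \<open>\<Prod>(1 - x t)\<close>: since \<open>-x t/(1 - x t) = 1 - \<Sum>\<^sub>m x\<^sup>m t\<^sup>m\<close>, its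
  product with \<open>t\<close> is the number of factors minus the generating function of the power sums.
\<close>

lemma power_sum_fps:
  fixes R :: "complex multiset"
  defines "Q \<equiv> (\<Prod>x\<in>#R. 1 - fps_const x * fps_X)"
  shows "fps_X * fps_deriv Q = (of_nat (size R) - Abs_fps (\<lambda>m. \<Sum>x\<in>#R. x ^ m)) * Q"
  unfolding Q_def
proof (induction R)
  case (add x R)
  define Q where "Q = (\<Prod>x\<in>#R. 1 - fps_const x * fps_X)"
  define S where "S = Abs_fps (\<lambda>m. \<Sum>x\<in>#R. x ^ m)"
  define g where "g = Abs_fps (\<lambda>m. x ^ m)"
  have "g = 1 + fps_X * (fps_const x * g)"
  proof (rule fps_ext)
    fix n
    show "fps_nth g n = fps_nth (1 + fps_X * (fps_const x * g)) n"
      by (cases n) (simp_all add: g_def)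
  qed
  then have g: "g * (1 - fps_const x * fps_X) = 1"
    by (simp add: algebra_simps)
  have S: "Abs_fps (\<lambda>m. \<Sum>x\<in>#add_mset x R. x ^ m) = g + S"
    by (rule fps_ext) (simp add: g_def S_def)
  have "fps_X * fps_deriv ((1 - fps_const x * fps_X) * Q)
      = (1 - fps_const x * fps_X) * (fps_X * fps_deriv Q) - fps_const x * fps_X * Q"
    by (simp add: algebra_simps)
  also have "\<dots> = (1 - fps_const x * fps_X) * ((of_nat (size R) - S) * Q)
      + ((1 - fps_const x * fps_X) - g * (1 - fps_const x * fps_X)) * Q"
    using add.IH by (simp add: Q_def S_def g)
  also have "\<dots> = (of_nat (size R + 1) - (g + S)) * ((1 - fps_const x * fps_X) * Q)"
    by (simp add: algebra_simps)
  finally show ?case unfolding S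
    by (simp only: image_mset_add_mset prod_mset.add_mset size_add_mset Suc_eq_plus1 flip: Q_def)
qed (simp add: fps_eq_iff)

context labelled_coords begin

text \<open>
  \<open>char_fps \<sigma>\<close> is \<open>E(t) = \<Sum>\<^sub>h (-1)\<^sup>h \<sigma>\<^sub>h t\<^sup>h\<close> with \<open>\<sigma>\<^sub>0 = 1\<close>, the reversal \<open>t\<^sup>k P\<^sub>\<sigma>(1/t)\<close> of the
  characteristic polynomial.  Its constant term is \<open>1\<close>, so it has an inverse \<open>G = inv_fps \<sigma>\<close>; the
  coefficients of \<open>G\<close> are the complete symmetric functions of the roots.
\<close>

definition char_fps :: "complex ^ 'n \<Rightarrow> complex fps" where
  "char_fps \<sigma> = Abs_fps (\<lambda>n. if n = 0 then 1 else if n \<le> CARD('n) then (- 1) ^ n * \<sigma> $ e n else 0)"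

definition inv_fps :: "complex ^ 'n \<Rightarrow> complex fps" where
  "inv_fps \<sigma> = inverse (char_fps \<sigma>)"

lemma char_fps_0: "fps_nth (char_fps \<sigma>) 0 = 1"
  by (simp add: char_fps_def)

lemma char_inv: "char_fps \<sigma> * inv_fps \<sigma> = 1"
  by (simp add: inv_fps_def char_fps_def inverse_mult_eq_1')

lemma inv_fps_0: "fps_nth (inv_fps \<sigma>) 0 = 1"
  by (simp add: inv_fps_def char_fps_def)

lemma coeff_P_poly:
  "coeff (P_poly e \<sigma>) i = (if i = CARD('n) then 1
     else if i < CARD('n) then (- 1) ^ (CARD('n) - i) * \<sigma> $ e (CARD('n) - i) else 0)"
proof -
  have "(\<Sum>h = 1..CARD('n). coeff (monom ((- 1) ^ h * \<sigma> $ e h) (CARD('n) - h)) i)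
      = (\<Sum>h = 1..CARD('n). if h = CARD('n) - i \<and> i < CARD('n) then (- 1) ^ h * \<sigma> $ e h else 0)"
    by (intro sum.cong refl) auto
  also have "\<dots> = (if i < CARD('n) then (- 1) ^ (CARD('n) - i) * \<sigma> $ e (CARD('n) - i) else 0)"
    by (cases "i < CARD('n)") (auto simp: sum.delta)
  finally show ?thesis by (simp add: P_poly_def coeff_sum)
qed

lemma degree_P_poly: "degree (P_poly e \<sigma>) = CARD('n)"
  by (rule antisym) (auto intro: degree_le le_degree simp: coeff_P_poly)

lemma char_fps_eq_prod:
  "char_fps \<sigma> = (\<Prod>x\<in>#proots (P_poly e \<sigma>). 1 - fps_const x * fps_X)"
  and size_proots_P_poly: "size (proots (P_poly e \<sigma>)) = CARD('n)"
proof -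
  obtain A where A: "size A = degree (P_poly e \<sigma>)"
    "P_poly e \<sigma> = smult (lead_coeff (P_poly e \<sigma>)) (\<Prod>x\<in>#A. [:-x, 1:])"
    using alg_closed_imp_factorization[of "P_poly e \<sigma>"] coeff_P_poly[of \<sigma> "CARD('n)"] by force
  moreover have lc: "lead_coeff (P_poly e \<sigma>) = 1" by (simp add: degree_P_poly coeff_P_poly)
  ultimately have P: "P_poly e \<sigma> = (\<Prod>x\<in>#A. [:-x, 1:])" by simp
  have R: "proots (\<Prod>x\<in>#B. [:-x, 1:]) = B" for B :: "complex multiset"
  proof (induction B)
    case (add x B)
    have "(\<Prod>x\<in>#B. [:-x, 1:]) \<noteq> (0 :: complex poly)" by auto
    then have "proots ([:-x, 1:] * (\<Prod>x\<in>#B. [:-x, 1:])) = proots [:-x, 1:] + proots (\<Prod>x\<in>#B. [:-x, 1:])"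
      by (intro proots_mult) simp_all
    then show ?case
      by (simp only: image_mset_add_mset prod_mset.add_mset add.IH proots_linear_factor) simp
  qed simp
  have "proots (P_poly e \<sigma>) = A" by (simp only: P R)
  then show "size (proots (P_poly e \<sigma>)) = CARD('n)" by (simp add: A(1) degree_P_poly)
  have "char_fps \<sigma> = fps_of_poly (reflect_poly (P_poly e \<sigma>))"
    by (rule fps_ext) (auto simp: coeff_reflect_poly degree_P_poly coeff_P_poly char_fps_def)
  also have "\<dots> = fps_of_poly (reflect_poly (\<Prod>x\<in>#A. [:-x, 1:]))" by (simp only: P)
  also have "\<dots> = (\<Prod>x\<in>#A. 1 - fps_const x * fps_X)"
  proof (induction A)
    case (add x B)
    have "reflect_poly [:- x, 1:] = [:1, - x:]"
      by (rule poly_eqI) (auto simp: coeff_reflect_poly coeff_pCons split: nat.splits)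
    then have "fps_of_poly (reflect_poly [:- x, 1:]) = 1 - fps_const x * fps_X"
      by (simp add: fps_of_poly_linear' flip: fps_const_neg)
    then show ?case
      by (simp only: image_mset_add_mset prod_mset.add_mset reflect_poly_mult fps_of_poly_mult add.IH)
  qed simp
  finally show "char_fps \<sigma> = (\<Prod>x\<in>#proots (P_poly e \<sigma>). 1 - fps_const x * fps_X)"
    unfolding \<open>proots (P_poly e \<sigma>) = A\<close> .
qed

lemma newton_fps:
  "Abs_fps (\<lambda>m. newton e m \<sigma>) = of_nat CARD('n) - fps_X * (fps_deriv (char_fps \<sigma>) * inv_fps \<sigma>)"
proof -
  have "fps_X * fps_deriv (char_fps \<sigma>) = (of_nat CARD('n) - Abs_fps (\<lambda>m. newton e m \<sigma>)) * char_fps \<sigma>"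
    using power_sum_fps[of "proots (P_poly e \<sigma>)"]
    by (simp add: newton_def size_proots_P_poly flip: char_fps_eq_prod)
  then have "fps_X * fps_deriv (char_fps \<sigma>) * inv_fps \<sigma>
      = (of_nat CARD('n) - Abs_fps (\<lambda>m. newton e m \<sigma>)) * (char_fps \<sigma> * inv_fps \<sigma>)"
    by (simp add: mult.assoc)
  then show ?thesis by (simp add: char_inv mult.assoc)
qed

lemma holo_char_fps: "holo_fps char_fps"
  unfolding holo_fps_def
proof
  fix n show "holo_on (\<lambda>\<sigma>. fps_nth (char_fps \<sigma>) n) UNIV"
    by (cases "n = 0"; cases "n \<le> CARD('n)")
       (simp_all add: char_fps_def holo_on_const holo_on_mult holo_on_coord)
qed

text \<open>
  The identity \<open>E G = 1\<close> expresses each coefficient of \<open>G\<close> through earlier ones and through \<open>E\<close>.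
\<close>

lemma holo_inv_fps: "holo_fps inv_fps"
  unfolding holo_fps_def
proof
  fix n show "holo_on (\<lambda>\<sigma>. fps_nth (inv_fps \<sigma>) n) UNIV"
  proof (induction n rule: less_induct)
    case (less n)
    show ?case
    proof (cases "n = 0")
      case False
      have eq: "fps_nth (inv_fps \<sigma>) n
          = (\<Sum>i=1..n. (- 1) * (fps_nth (char_fps \<sigma>) i * fps_nth (inv_fps \<sigma>) (n - i)))" for \<sigma>
      proof -
        have "0 = fps_nth (char_fps \<sigma> * inv_fps \<sigma>) n" using False by (simp add: char_inv)
        also have "\<dots> = fps_nth (char_fps \<sigma>) 0 * fps_nth (inv_fps \<sigma>) n
            + (\<Sum>i=1..n. fps_nth (char_fps \<sigma>) i * fps_nth (inv_fps \<sigma>) (n - i))"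
          by (simp add: fps_mult_nth sum.atLeast_Suc_atMost)
        finally show ?thesis by (simp add: char_fps_0 sum_negf eq_neg_iff_add_eq_0)
      qed
      show ?thesis
        unfolding eq
        by (intro holo_on_sum holo_on_mult holo_on_const)
           (use less holo_char_fps in \<open>auto simp: holo_fps_def\<close>)
    qed (simp add: inv_fps_0 holo_on_const)
  qed
qed

lemma pd_char_fps:
  assumes "h \<in> {1..CARD('n)}"
  shows "pd_fps (e h) char_fps \<sigma> = fps_const ((- 1) ^ h) * fps_X ^ h"
proof (rule fps_ext)
  fix n
  consider "n = 0" | "n \<in> {1..CARD('n)}" | "n > CARD('n)" by fastforce
  then show "fps_nth (pd_fps (e h) char_fps \<sigma>) n = fps_nth (fps_const ((- 1) ^ h) * fps_X ^ h) n"
  proof cases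
    case 2
    have "pd (e h) (\<lambda>\<tau>. (- 1) ^ n * \<tau> $ e n) \<sigma> = (- 1) ^ n * (if h = n then 1 else 0)"
      using pd_cmult[OF holo_on_coord, of \<sigma> UNIV "e h" "(- 1) ^ n" "e n"] 2 assms
      by (simp add: pd_coord e_eq_iff)
    then show ?thesis using 2 by (simp add: pd_fps_def char_fps_def fps_X_power_iff)
  qed (use assms in \<open>auto simp: pd_fps_def char_fps_def pd_const fps_X_power_iff\<close>)
qed

lemma pd_inv_fps:
  assumes "h \<in> {1..CARD('n)}"
  shows "pd_fps (e h) inv_fps \<sigma> = - (fps_const ((- 1) ^ h) * fps_X ^ h * inv_fps \<sigma> ^ 2)"
proof -
  have "0 = pd_fps (e h) (\<lambda>\<sigma>. char_fps \<sigma> * inv_fps \<sigma>) \<sigma>"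
    by (simp add: char_inv pd_fps_const)
  also have "\<dots> = fps_const ((- 1) ^ h) * fps_X ^ h * inv_fps \<sigma> + char_fps \<sigma> * pd_fps (e h) inv_fps \<sigma>"
    by (simp only: pd_fps_mult[OF holo_char_fps holo_inv_fps] pd_char_fps[OF assms])
  finally have "0 = inv_fps \<sigma> * (fps_const ((- 1) ^ h) * fps_X ^ h * inv_fps \<sigma>
      + char_fps \<sigma> * pd_fps (e h) inv_fps \<sigma>)" by simp
  also have "\<dots> = fps_const ((- 1) ^ h) * fps_X ^ h * inv_fps \<sigma> ^ 2
      + (char_fps \<sigma> * inv_fps \<sigma>) * pd_fps (e h) inv_fps \<sigma>"
    by (simp add: algebra_simps power2_eq_square)
  finally show ?thesis by (simp add: char_inv eq_neg_iff_add_eq_0 add.commute)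
qed

text \<open>
  Differentiating \<open>\<Sum>\<^sub>m N\<^sub>m t\<^sup>m = k - t E' G\<close> with \<open>\<partial>\<^sub>h E = (-1)\<^sup>h t\<^sup>h\<close>, \<open>\<partial>\<^sub>h G = - \<partial>\<^sub>h E G\<^sup>2\<close> and
  \<open>G' = - E' G\<^sup>2\<close> gives \<open>- t (\<partial>\<^sub>h E G)'\<close>; the operator \<open>t d/dt\<close> is the source of the factor \<open>m\<close>.
\<close>

lemma pd_newton:
  assumes "h \<in> {1..CARD('n)}"
  shows "pd (e h) (newton e m) \<sigma> = (- 1) ^ Suc h * of_nat m * fps_nth (fps_X ^ h * inv_fps \<sigma>) m"
proof -
  let ?c = "fps_const ((- 1) ^ h) * fps_X ^ h :: complex fps"
  have di: "fps_deriv (inv_fps \<sigma>) = - fps_deriv (char_fps \<sigma>) * inv_fps \<sigma> ^ 2"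
  proof -
    have "0 = fps_deriv (char_fps \<sigma> * inv_fps \<sigma>)" by (simp add: char_inv)
    then have "0 = inv_fps \<sigma> * (char_fps \<sigma> * fps_deriv (inv_fps \<sigma>) + fps_deriv (char_fps \<sigma>) * inv_fps \<sigma>)"
      by simp
    also have "\<dots> = (char_fps \<sigma> * inv_fps \<sigma>) * fps_deriv (inv_fps \<sigma>)
        + fps_deriv (char_fps \<sigma>) * inv_fps \<sigma> ^ 2"
      by (simp add: algebra_simps power2_eq_square)
    finally show ?thesis by (simp add: char_inv eq_neg_iff_add_eq_0 add.commute)
  qed
  have N: "(\<lambda>\<sigma>. Abs_fps (\<lambda>m. newton e m \<sigma>)) =
      (\<lambda>\<sigma>. of_nat CARD('n) + (- fps_X) * (fps_deriv (char_fps \<sigma>) * inv_fps \<sigma>))"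
    by (simp add: newton_fps)
  have "pd_fps (e h) (\<lambda>\<sigma>. (- fps_X) * (fps_deriv (char_fps \<sigma>) * inv_fps \<sigma>)) \<sigma>
      = (- fps_X) * (fps_deriv ?c * inv_fps \<sigma>
           + fps_deriv (char_fps \<sigma>) * (- (?c * inv_fps \<sigma> ^ 2)))"
    by (simp only: pd_fps_mult[OF holo_fps_const holo_fps_mult[OF holo_fps_deriv[OF holo_char_fps] holo_inv_fps]]
        pd_fps_mult[OF holo_fps_deriv[OF holo_char_fps] holo_inv_fps] pd_fps_const
        pd_fps_deriv[OF holo_char_fps] pd_char_fps[OF assms] pd_inv_fps[OF assms] mult_zero_left add_0_left)
  also have "\<dots> = - (fps_X * fps_deriv (?c * inv_fps \<sigma>))"
    by (simp only: fps_deriv_mult di) (simp add: algebra_simps)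
  finally have "pd_fps (e h) (\<lambda>\<sigma>. (- fps_X) * (fps_deriv (char_fps \<sigma>) * inv_fps \<sigma>)) \<sigma>
      = - (fps_X * fps_deriv (?c * inv_fps \<sigma>))" .
  moreover have "pd_fps (e h) (\<lambda>\<sigma>. Abs_fps (\<lambda>m. newton e m \<sigma>)) \<sigma>
      = pd_fps (e h) (\<lambda>\<sigma>. (- fps_X) * (fps_deriv (char_fps \<sigma>) * inv_fps \<sigma>)) \<sigma>"
  proof -
    have "holo_fps (\<lambda>\<sigma>. (- fps_X) * (fps_deriv (char_fps \<sigma>) * inv_fps \<sigma>))"
      by (intro holo_fps_mult holo_fps_const holo_fps_deriv holo_char_fps holo_inv_fps)
    then show ?thesis
      unfolding N unfolding pd_fps_def holo_fps_def fps_add_nth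
      by (intro arg_cong[of _ _ Abs_fps] ext)
         (simp add: pd_add[where W = UNIV] holo_on_const pd_const)
  qed
  ultimately have "fps_nth (pd_fps (e h) (\<lambda>\<sigma>. Abs_fps (\<lambda>m. newton e m \<sigma>)) \<sigma>) m
      = fps_nth (- (fps_X * fps_deriv (?c * inv_fps \<sigma>))) m" by simp
  also have "\<dots> = - (of_nat m * fps_nth (?c * inv_fps \<sigma>) m)"
    by (cases m) (simp_all add: algebra_simps del: fps_deriv_mult)
  finally show ?thesis by (simp add: pd_fps_def mult.assoc)
qed

text \<open>
  Each further derivation acts by \<open>\<partial>\<^sub>h G\<^sup>r = - r (-1)\<^sup>h t\<^sup>h G\<^sup>r\<^sup>+\<^sup>1\<close>.  The right-hand side depends on \<open>w\<close> only
  through its length and its weight, which is why the exchange operators annihilate \<open>N\<^sub>m\<close>.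
\<close>

lemma word_pd_newton:
  assumes "w \<noteq> []" "letters CARD('n) w"
  shows "word_pd e w (newton e m) \<sigma> = (- 1) ^ (length w + sum_list w) * fact (length w - 1) * of_nat m *
           fps_nth (fps_X ^ sum_list w * inv_fps \<sigma> ^ length w) m"
  using assms
proof (induction w arbitrary: \<sigma> rule: list_nonempty_induct)
  case (single h)
  then show ?case by (simp add: pd_newton)
next
  case (cons h w)
  define r where "r = length w - 1"
  have r: "length w = Suc r" using cons by (simp add: r_def)
  define c where "c = (- 1) ^ (length w + sum_list w) * fact r * (of_nat m :: complex)"
  have eq: "word_pd e w (newton e m) = (\<lambda>\<sigma>. c * fps_nth (fps_X ^ sum_list w * inv_fps \<sigma> ^ Suc r) m)"
    using cons by (auto simp: c_def r_def fun_eq_iff)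
  have hF: "holo_fps (\<lambda>\<sigma>. fps_X ^ sum_list w * inv_fps \<sigma> ^ Suc r)"
    by (intro holo_fps_mult holo_fps_power holo_inv_fps holo_fps_const)
  have "word_pd e (h # w) (newton e m) \<sigma>
      = c * fps_nth (pd_fps (e h) (\<lambda>\<sigma>. fps_X ^ sum_list w * inv_fps \<sigma> ^ Suc r) \<sigma>) m"
    unfolding word_pd.simps eq pd_fps_def fps_nth_Abs_fps
    by (rule pd_cmult[where W = UNIV]) (use hF in \<open>auto simp: holo_fps_def\<close>)
  also have "pd_fps (e h) (\<lambda>\<sigma>. fps_X ^ sum_list w * inv_fps \<sigma> ^ Suc r) \<sigma>
      = fps_X ^ sum_list w * (of_nat (Suc r) * inv_fps \<sigma> ^ r *
          - (fps_const ((- 1) ^ h) * fps_X ^ h * inv_fps \<sigma> ^ 2))"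
    using pd_fps_mult[OF holo_fps_const holo_fps_power[OF holo_inv_fps], of "e h" "fps_X ^ sum_list w" "Suc r" \<sigma>]
      cons.prems
    by (simp only: pd_fps_const pd_fps_power[OF holo_inv_fps]) (simp add: pd_inv_fps)
  also have "\<dots> = fps_const (- ((- 1) ^ h * of_nat (Suc r))) *
      (fps_X ^ (h + sum_list w) * inv_fps \<sigma> ^ Suc (Suc r))"
    by (simp add: fps_of_nat[symmetric] power_add power2_eq_square mult_ac flip: fps_const_neg fps_const_mult del: of_nat_Suc)
  finally have "word_pd e (h # w) (newton e m) \<sigma> = (c * - ((- 1) ^ h * of_nat (Suc r))) *
      fps_nth (fps_X ^ (h + sum_list w) * inv_fps \<sigma> ^ Suc (Suc r)) m"
    by (simp only: fps_mult_left_const_nth mult.assoc)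
  moreover have "c * - ((- 1) ^ h * of_nat (Suc r))
      = (- 1) ^ (Suc (Suc r) + (h + sum_list w)) * fact (Suc r) * of_nat m"
    by (simp add: c_def r power_add)
  ultimately show ?case by (simp only: r sum_list.Cons list.size(4) add_0_right add_Suc_right diff_Suc_1)
qed

lemma holo_newton: "holo_on (newton e m) W"
proof -
  have "holo_fps (\<lambda>\<sigma>. (- fps_X) * (fps_deriv (char_fps \<sigma>) * inv_fps \<sigma>))"
    by (intro holo_fps_mult holo_fps_const holo_fps_deriv holo_char_fps holo_inv_fps)
  then have "holo_on (\<lambda>\<sigma>. fps_nth (of_nat CARD('n)) m +
      fps_nth ((- fps_X) * (fps_deriv (char_fps \<sigma>) * inv_fps \<sigma>)) m) UNIV"
    unfolding holo_fps_def by (intro holo_on_add holo_on_const) auto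
  also have "(\<lambda>\<sigma>. fps_nth (of_nat CARD('n)) m +
      fps_nth ((- fps_X) * (fps_deriv (char_fps \<sigma>) * inv_fps \<sigma>)) m) = newton e m"
  proof
    fix \<sigma>
    show "fps_nth (of_nat CARD('n)) m +
      fps_nth ((- fps_X) * (fps_deriv (char_fps \<sigma>) * inv_fps \<sigma>)) m = newton e m \<sigma>"
      using arg_cong[OF newton_fps[of \<sigma>], of "\<lambda>F. fps_nth F m"] by simp
  qed
  finally show ?thesis by (rule holo_on_subset) simp
qed

end

section \<open>Finite order operators and the left ideal\<close>

context labelled_coords begin

lemma multi_pd_eq_word_pd:
  "multi_pd e \<alpha> = word_pd e (concat (map (\<lambda>h. replicate (\<alpha> (e h)) h) [1..<Suc CARD('n)]))"
proof -
  have rep: "word_pd e (replicate c h) f = (pd (e h) ^^ c) f" for c h f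
    by (induction c) simp_all
  have "foldr (\<lambda>h T. (pd (e h) ^^ \<alpha> (e h)) \<circ> T) hs id f
      = word_pd e (concat (map (\<lambda>h. replicate (\<alpha> (e h)) h) hs)) f" for hs f
    by (induction hs) (simp_all add: word_pd_append rep)
  then show ?thesis unfolding multi_pd_def by (rule ext)
qed

text \<open>
  The fixed order of the coordinates in \<open>multi_pd\<close> is reached by sorting the word.
\<close>

lemma word_pd_eq_multi_pd:
  assumes "letters CARD('n) w"
  obtains \<alpha> where
    "\<And>W f x. open W \<Longrightarrow> holo_on f W \<Longrightarrow> x \<in> W \<Longrightarrow> word_pd e w f x = multi_pd e \<alpha> f x"
proof
  define \<alpha> where "\<alpha> = (\<lambda>j. count (mset w) (the_inv_into {1..CARD('n)} e j))"
  have \<alpha>: "\<alpha> (e h) = count (mset w) h" if "h \<in> {1..CARD('n)}" for h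
    unfolding \<alpha>_def using the_inv_into_f_f[OF bij_betw_imp_inj_on[OF bij] that] by simp
  have "count (mset (concat (map (\<lambda>h. replicate (c h) h) hs))) y = (if y \<in> set hs then c y else 0)"
    if "distinct hs" for c hs and y :: nat
    using that by (induction hs) (auto simp: count_replicate_mset)
  from this[of "[1..<Suc CARD('n)]" "\<lambda>h. \<alpha> (e h)"]
  have "count (mset (concat (map (\<lambda>h. replicate (\<alpha> (e h)) h) [1..<Suc CARD('n)]))) y
      = (if y \<in> {1..CARD('n)} then \<alpha> (e y) else 0)" for y
    by (simp add: atLeastLessThanSuc_atLeastAtMost del: upt_Suc)
  also have "\<dots> y = count (mset w) y" for y
    using assms \<alpha> by (auto simp: count_eq_zero_iff subset_iff not_in_iff)
  finally have "mset w = mset (concat (map (\<lambda>h. replicate (\<alpha> (e h)) h) [1..<Suc CARD('n)]))"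
    by (intro multiset_eqI) simp
  then show "word_pd e w f x = multi_pd e \<alpha> f x" if "open W" "holo_on f W" "x \<in> W" for W f x
    unfolding multi_pd_eq_word_pd by (intro word_pd_mset[OF that(1,2) _ that(3)])
qed

end

lemma finite_multi_indices: "finite {\<alpha> :: 'n::finite \<Rightarrow> nat. (\<Sum>j\<in>UNIV. \<alpha> j) \<le> d}"
proof (rule finite_subset)
  show "{\<alpha> :: 'n \<Rightarrow> nat. (\<Sum>j\<in>UNIV. \<alpha> j) \<le> d} \<subseteq> Pi\<^sub>E UNIV (\<lambda>_. {..d})"
  proof
    fix \<alpha> :: "'n \<Rightarrow> nat" assume "\<alpha> \<in> {\<alpha>. (\<Sum>j\<in>UNIV. \<alpha> j) \<le> d}"
    moreover have "\<alpha> i \<le> (\<Sum>j\<in>UNIV. \<alpha> j)" for i by (rule member_le_sum) simp_all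
    ultimately show "\<alpha> \<in> Pi\<^sub>E UNIV (\<lambda>_. {..d})" by (auto intro: order_trans)
  qed
  show "finite (Pi\<^sub>E (UNIV :: 'n set) (\<lambda>_. {..d}))" by (intro finite_PiE) simp_all
qed

lemma finite_order_smult:
  assumes "finite_order_on e V T" "holo_on c V"
  shows "finite_order_on e V (\<lambda>f x. c x * T f x)"
proof -
  obtain d a where a: "\<And>\<alpha>. holo_on (a \<alpha>) V"
    "op_eq V T (\<lambda>f x. \<Sum>\<alpha> | (\<Sum>j\<in>UNIV. \<alpha> j) \<le> (d::nat). a \<alpha> x * multi_pd e \<alpha> f x)"
    using assms(1) unfolding finite_order_on_def by blast
  show ?thesis
    unfolding finite_order_on_def
    by (rule exI[of _ d], rule exI[of _ "\<lambda>\<alpha> x. c x * a \<alpha> x"])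
       (use a(2) in \<open>auto simp: op_eq_def sum_distrib_left mult.assoc intro!: holo_on_mult a(1) assms(2)\<close>)
qed

lemma finite_order_zero: "finite_order_on e V (\<lambda>f x. 0)"
  unfolding finite_order_on_def
  by (rule exI[of _ 0], rule exI[of _ "\<lambda>\<alpha> x. 0"]) (simp add: op_eq_def holo_on_const)

lemma finite_order_add:
  assumes "finite_order_on e V S" "finite_order_on e V T"
  shows "finite_order_on e V (\<lambda>f x. S f x + T f x)"
proof -
  have ext: "\<exists>a'. (\<forall>\<alpha>. holo_on (a' \<alpha>) V) \<and> op_eq V R
        (\<lambda>f x. \<Sum>\<alpha> | (\<Sum>j\<in>UNIV. \<alpha> j) \<le> D. a' \<alpha> x * multi_pd e \<alpha> f x)"
    if a: "\<And>\<alpha>. holo_on (a \<alpha>) V"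
      "op_eq V R (\<lambda>f x. \<Sum>\<alpha> | (\<Sum>j\<in>UNIV. \<alpha> j) \<le> (d::nat). a \<alpha> x * multi_pd e \<alpha> f x)"
      and le: "d \<le> D" for R a d D
  proof -
    define a' where "a' = (\<lambda>\<alpha>. if (\<Sum>j\<in>UNIV. \<alpha> j) \<le> d then a \<alpha> else (\<lambda>x. 0))"
    have "(\<Sum>\<alpha> | (\<Sum>j\<in>UNIV. \<alpha> j) \<le> d. a \<alpha> x * multi_pd e \<alpha> f x)
        = (\<Sum>\<alpha> | (\<Sum>j\<in>UNIV. \<alpha> j) \<le> D. a' \<alpha> x * multi_pd e \<alpha> f x)" for f x
      by (rule sum.mono_neutral_cong_left) (use le in \<open>auto simp: a'_def finite_multi_indices\<close>)
    moreover have "holo_on (a' \<alpha>) V" for \<alpha>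
      by (simp add: a'_def a(1) holo_on_const)
    ultimately show ?thesis using a(2) by (intro exI[of _ a']) (auto simp: op_eq_def)
  qed
  obtain d1 a1 where a1: "\<And>\<alpha>. holo_on (a1 \<alpha>) V"
    "op_eq V S (\<lambda>f x. \<Sum>\<alpha> | (\<Sum>j\<in>UNIV. \<alpha> j) \<le> (d1::nat). a1 \<alpha> x * multi_pd e \<alpha> f x)"
    using assms(1) unfolding finite_order_on_def by blast
  obtain d2 a2 where a2: "\<And>\<alpha>. holo_on (a2 \<alpha>) V"
    "op_eq V T (\<lambda>f x. \<Sum>\<alpha> | (\<Sum>j\<in>UNIV. \<alpha> j) \<le> (d2::nat). a2 \<alpha> x * multi_pd e \<alpha> f x)"
    using assms(2) unfolding finite_order_on_def by blast
  define D where "D = max d1 d2"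
  obtain b1 where b1: "\<And>\<alpha>. holo_on (b1 \<alpha>) V"
    "op_eq V S (\<lambda>f x. \<Sum>\<alpha> | (\<Sum>j\<in>UNIV. \<alpha> j) \<le> D. b1 \<alpha> x * multi_pd e \<alpha> f x)"
    using ext[OF a1, of D] by (auto simp: D_def)
  obtain b2 where b2: "\<And>\<alpha>. holo_on (b2 \<alpha>) V"
    "op_eq V T (\<lambda>f x. \<Sum>\<alpha> | (\<Sum>j\<in>UNIV. \<alpha> j) \<le> D. b2 \<alpha> x * multi_pd e \<alpha> f x)"
    using ext[OF a2, of D] by (auto simp: D_def)
  show ?thesis
    unfolding finite_order_on_def
    by (rule exI[of _ D], rule exI[of _ "\<lambda>\<alpha> x. b1 \<alpha> x + b2 \<alpha> x"])
       (use b1(2) b2(2) in \<open>auto simp: op_eq_def sum.distrib distrib_right intro!: holo_on_add b1(1) b2(1)\<close>)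
qed

context labelled_coords begin

lemma finite_order_word_pd:
  assumes "letters CARD('n) w"
  shows "finite_order_on e V (word_pd e w)"
proof -
  obtain \<alpha> where \<alpha>:
    "\<And>W f x. open W \<Longrightarrow> holo_on f W \<Longrightarrow> x \<in> W \<Longrightarrow> word_pd e w f x = multi_pd e \<alpha> f x"
    using word_pd_eq_multi_pd[OF assms] by blast
  define a where "a = (\<lambda>\<beta> (x :: complex ^ 'n). if \<beta> = \<alpha> then 1 else 0 :: complex)"
  have "(\<Sum>\<beta> | (\<Sum>j\<in>UNIV. \<beta> j) \<le> (\<Sum>j\<in>UNIV. \<alpha> j). a \<beta> x * multi_pd e \<beta> f x) = multi_pd e \<alpha> f x" for f x
    by (simp add: a_def if_distrib[of "\<lambda>z. z * _"] sum.delta finite_multi_indices cong: if_cong)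
  moreover have "holo_on (a \<beta>) V" for \<beta> by (simp add: a_def holo_on_const)
  ultimately show ?thesis
    unfolding finite_order_on_def
    by (intro exI[of _ "\<Sum>j\<in>UNIV. \<alpha> j"] exI[of _ a]) (auto simp: op_eq_def \<alpha>)
qed

lemma finite_J_generators: "finite (J_generators e)"
proof -
  let ?k = "int CARD('n)"
  have "{exchange_op e p q i | p q i. {p, q, p + i, q - i} \<subseteq> {1..?k}}
      \<subseteq> (\<lambda>(p, q, i). exchange_op e p q i) ` ({1..?k} \<times> {1..?k} \<times> {-?k..?k})"
    by force
  then have "finite {exchange_op e p q i | p q i. {p, q, p + i, q - i} \<subseteq> {1..?k}}"
    by (rule finite_subset) simp
  moreover have "{T_op e m | m. m \<in> {2..CARD('n)}} = T_op e ` {2..CARD('n)}" by blast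
  ultimately show ?thesis unfolding J_generators_def by simp
qed

text \<open>
  Membership in the left ideal generated over \<open>V\<close>.  The set of generators is finite, so every
  member can be written with one coefficient operator for each generator, and sums of members
  need no bookkeeping of different finite subsets.
\<close>

definition in_ideal :: "(complex ^ 'n) set \<Rightarrow> 'n oper \<Rightarrow> bool" where
  "in_ideal V T \<longleftrightarrow> (\<exists>Q. (\<forall>g\<in>J_generators e. finite_order_on e V (Q g)) \<and>
     op_eq V T (\<lambda>f x. \<Sum>g\<in>J_generators e. Q g (g f) x))"

lemma in_ideal_zero: "in_ideal V (\<lambda>f x. 0)"
  unfolding in_ideal_def by (rule exI[of _ "\<lambda>g f x. 0"]) (simp add: finite_order_zero op_eq_def)

lemma in_ideal_cong: "in_ideal V T \<Longrightarrow> op_eq V S T \<Longrightarrow> in_ideal V S"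
  unfolding in_ideal_def op_eq_def by fastforce

lemma in_ideal_add:
  assumes "in_ideal V S" "in_ideal V T"
  shows "in_ideal V (\<lambda>f x. S f x + T f x)"
proof -
  obtain Q1 Q2 where "\<forall>g\<in>J_generators e. finite_order_on e V (Q1 g)"
    "op_eq V S (\<lambda>f x. \<Sum>g\<in>J_generators e. Q1 g (g f) x)"
    "\<forall>g\<in>J_generators e. finite_order_on e V (Q2 g)"
    "op_eq V T (\<lambda>f x. \<Sum>g\<in>J_generators e. Q2 g (g f) x)"
    using assms unfolding in_ideal_def by blast
  then show ?thesis
    unfolding in_ideal_def
    by (intro exI[of _ "\<lambda>g f x. Q1 g f x + Q2 g f x"])
       (auto simp: finite_order_add op_eq_def sum.distrib)
qed

lemma in_ideal_smult:
  assumes "in_ideal V T" "holo_on c V"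
  shows "in_ideal V (\<lambda>f x. c x * T f x)"
proof -
  obtain Q where "\<forall>g\<in>J_generators e. finite_order_on e V (Q g)"
    "op_eq V T (\<lambda>f x. \<Sum>g\<in>J_generators e. Q g (g f) x)"
    using assms unfolding in_ideal_def by blast
  then show ?thesis
    unfolding in_ideal_def
    by (intro exI[of _ "\<lambda>g f x. c x * Q g f x"])
       (auto simp: finite_order_smult assms(2) op_eq_def sum_distrib_left)
qed

lemma in_ideal_generator:
  assumes "g \<in> J_generators e" "letters CARD('n) w"
  shows "in_ideal V (\<lambda>f. word_pd e w (g f))"
proof -
  define Q where "Q = (\<lambda>g'. if g' = g then word_pd e w else (\<lambda>f x. 0))"
  have "(\<Sum>g'\<in>J_generators e. Q g' (g' f) x) = word_pd e w (g f) x" for f x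
  proof -
    have "(\<Sum>g'\<in>J_generators e. Q g' (g' f) x)
        = (\<Sum>g'\<in>J_generators e. if g' = g then word_pd e w (g f) x else 0)"
      by (intro sum.cong) (auto simp: Q_def)
    then show ?thesis using assms(1) finite_J_generators by simp
  qed
  moreover have "finite_order_on e V (Q g')" for g'
    by (cases "g' = g") (simp_all add: Q_def finite_order_zero finite_order_word_pd[OF assms(2)])
  ultimately show ?thesis
    unfolding in_ideal_def by (intro exI[of _ Q]) (simp add: op_eq_def)
qed

section \<open>Words of equal length and weight\<close>

text \<open>
  Quantifying over all words multiplied from the left builds compatibility with prefixed letters
  into the relation.
\<close>

definition word_equiv :: "(complex ^ 'n) set \<Rightarrow> nat list \<Rightarrow> nat list \<Rightarrow> bool" where
  "word_equiv V u v \<longleftrightarrow> (\<forall>c. letters CARD('n) c \<longrightarrow>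
     in_ideal V (\<lambda>f x. word_pd e (c @ u) f x - word_pd e (c @ v) f x))"

lemma word_equiv_sym: "word_equiv V u v \<Longrightarrow> word_equiv V v u"
  unfolding word_equiv_def
proof (intro allI impI)
  fix c assume "\<forall>c. letters CARD('n) c \<longrightarrow> in_ideal V (\<lambda>f x. word_pd e (c @ u) f x - word_pd e (c @ v) f x)"
    and "letters CARD('n) c"
  then have "in_ideal V (\<lambda>f x. (- 1) * (word_pd e (c @ u) f x - word_pd e (c @ v) f x))"
    by (intro in_ideal_smult holo_on_const) blast
  then show "in_ideal V (\<lambda>f x. word_pd e (c @ v) f x - word_pd e (c @ u) f x)" by simp
qed

lemma word_equiv_trans [trans]:
  assumes "word_equiv V u v" "word_equiv V v w"
  shows "word_equiv V u w"
  unfolding word_equiv_def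
proof (intro allI impI)
  fix c assume "letters CARD('n) c"
  then have "in_ideal V (\<lambda>f x. (word_pd e (c @ u) f x - word_pd e (c @ v) f x)
      + (word_pd e (c @ v) f x - word_pd e (c @ w) f x))"
    using assms unfolding word_equiv_def by (intro in_ideal_add) blast+
  then show "in_ideal V (\<lambda>f x. word_pd e (c @ u) f x - word_pd e (c @ w) f x)" by simp
qed

lemma word_equiv_mset: "mset u = mset v \<Longrightarrow> word_equiv V u v"
  unfolding word_equiv_def
  by (intro allI impI in_ideal_cong[OF in_ideal_zero])
     (auto simp: op_eq_def intro: word_pd_mset)

lemma word_equiv_Cons:
  assumes "a \<in> {1..CARD('n)}" "word_equiv V u v"
  shows "word_equiv V (a # u) (a # v)"
  unfolding word_equiv_def
proof (intro allI impI)
  fix c assume "letters CARD('n) c"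
  then have "letters CARD('n) (c @ [a])" using assms(1) by simp
  then have "in_ideal V (\<lambda>f x. word_pd e ((c @ [a]) @ u) f x - word_pd e ((c @ [a]) @ v) f x)"
    using assms(2) unfolding word_equiv_def by blast
  then show "in_ideal V (\<lambda>f x. word_pd e (c @ a # u) f x - word_pd e (c @ a # v) f x)"
    by simp
qed

lemma word_equiv_exchange:
  assumes "letters CARD('n) (p # q # w)" "p < CARD('n)" "q > 1"
  shows "word_equiv V (p # q # w) (Suc p # (q - 1) # w)"
  unfolding word_equiv_def
proof (intro allI impI)
  fix c assume c: "letters CARD('n) c"
  let ?g = "exchange_op e (int p) (int q) 1"
  have nats: "nat (int p) = p" "nat (int q) = q" "nat (int p + 1) = Suc p" "nat (int q - 1) = q - 1"
    by auto
  have "{int p, int q, int p + 1, int q - 1} \<subseteq> {1..int CARD('n)}" using assms by auto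
  then have "?g \<in> J_generators e" unfolding J_generators_def by blast
  then have "in_ideal V (\<lambda>f. word_pd e (c @ w) (?g f))"
    using assms c by (intro in_ideal_generator) auto
  then show "in_ideal V (\<lambda>f x. word_pd e (c @ p # q # w) f x - word_pd e (c @ Suc p # (q - 1) # w) f x)"
  proof (rule in_ideal_cong, unfold op_eq_def, intro allI impI ballI)
    fix W and f :: "complex ^ 'n \<Rightarrow> complex" and x assume W: "open W" "holo_on f W" "x \<in> W"
    have "word_pd e (c @ w) (?g f) x
        = word_pd e (c @ w) (\<lambda>y. pd (e p) (pd (e q) f) y - pd (e (Suc p)) (pd (e (q - 1)) f) y) x"
      using W by (intro word_pd_cong[of W]) (simp_all only: exchange_op_def nats)
    also have "\<dots> = word_pd e (c @ w) (pd (e p) (pd (e q) f)) x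
        - word_pd e (c @ w) (pd (e (Suc p)) (pd (e (q - 1)) f)) x"
      using W by (intro word_pd_diff[of W] pd_holo(1)) auto
    also have "\<dots> = word_pd e ((c @ w) @ [p, q]) f x - word_pd e ((c @ w) @ [Suc p, q - 1]) f x"
      by (simp only: word_pd_append[of e "c @ w"] word_pd.simps)
    also have "\<dots> = word_pd e (c @ p # q # w) f x - word_pd e (c @ Suc p # (q - 1) # w) f x"
      by (intro arg_cong2[of _ _ _ _ "(-)"] word_pd_mset[OF W(1,2) _ W(3)]) simp_all
    finally show "word_pd e (c @ p # q # w) f x - word_pd e (c @ Suc p # (q - 1) # w) f x
      = word_pd e (c @ w) (?g f) x" by simp
  qed
qed

lemma length_le_sum_list: "letters k w \<Longrightarrow> length w \<le> sum_list w"
  and sum_list_le: "letters k w \<Longrightarrow> sum_list w \<le> length w * k"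
  by (induction w) auto

text \<open>
  If \<open>a < b\<close> then the rest of the first word outweighs the rest of the second, which has the same
  length and letters at least \<open>1\<close>; so the first has a letter above \<open>1\<close>, from which one unit can be
  moved to the head.
\<close>

lemma word_equiv_raise_head:
  assumes "letters CARD('n) (a # u)" "letters CARD('n) (b # v)" "a < b"
    "length u = length v" "a + sum_list u = b + sum_list v"
  obtains u' where "word_equiv V (a # u) (Suc a # u')" "letters CARD('n) (Suc a # u')"
    "length u' = length v" "Suc a + sum_list u' = b + sum_list v"
proof -
  have "\<exists>q\<in>set u. q > 1"
  proof (rule ccontr)
    assume "\<not> (\<exists>q\<in>set u. q > 1)"
    then have "sum_list u \<le> length u" by (induction u) (auto simp: not_less)
    moreover have "length v \<le> sum_list v" using assms(2) by (intro length_le_sum_list) auto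
    ultimately show False using assms by linarith
  qed
  then obtain q x y where q: "q > 1" "u = x @ q # y" by (meson split_list)
  have "word_equiv V (a # u) (a # q # x @ y)"
    by (rule word_equiv_mset) (simp add: q)
  also have "word_equiv V \<dots> (Suc a # (q - 1) # x @ y)"
    by (rule word_equiv_exchange) (use assms q in auto)
  finally show thesis by (rule that) (use assms q in auto)
qed

text \<open>
  Units are moved to the head with the smaller letter until the heads agree; then the tails agree
  in length and weight and the argument repeats.
\<close>

lemma word_equiv_same_weight:
  assumes "length u = length v" "sum_list u = sum_list v" "letters CARD('n) u" "letters CARD('n) v"
  shows "word_equiv V u v"
  using assms
proof (induction "length u" arbitrary: u v)
  case 0
  then show ?case by (simp add: word_equiv_mset)
next
  case (Suc n)
  have "word_equiv V (a # u) (b # v)"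
    if "length u = n" "length v = n" "a + sum_list u = b + sum_list v"
      "letters CARD('n) (a # u)" "letters CARD('n) (b # v)" for a b u v
    using that
  proof (induction "(a - b) + (b - a)" arbitrary: a b u v rule: less_induct)
    case less
    consider "a = b" | "a < b" | "b < a" by linarith
    then show ?case
    proof cases
      case 1
      then have "word_equiv V u v"
        using less.prems by (intro Suc.hyps(1)) auto
      then show ?thesis using 1 less.prems by (auto intro: word_equiv_Cons)
    next
      case 2
      obtain u' where u': "word_equiv V (a # u) (Suc a # u')" "letters CARD('n) (Suc a # u')"
          "length u' = length v" "Suc a + sum_list u' = b + sum_list v"
        by (rule word_equiv_raise_head[of a u b v]) (use less.prems 2 in auto)
      note u'(1)
      also have "word_equiv V (Suc a # u') (b # v)"
        by (rule less.hyps) (use less.prems 2 u' in auto)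
      finally show ?thesis .
    next
      case 3
      obtain w where w: "word_equiv V (b # v) (Suc b # w)" "letters CARD('n) (Suc b # w)"
          "length w = length u" "Suc b + sum_list w = a + sum_list u"
        by (rule word_equiv_raise_head[of b v a u]) (use less.prems 3 in auto)
      have "word_equiv V (a # u) (Suc b # w)"
        by (rule less.hyps) (use less.prems 3 w in auto)
      also note word_equiv_sym[OF w(1)]
      finally show ?thesis .
    qed
  qed
  moreover obtain a u' where "u = a # u'" using Suc.hyps(2) by (cases u) auto
  moreover obtain b v' where "v = b # v'" using Suc.hyps(2) Suc.prems(1) by (cases v) auto
  ultimately show ?case using Suc.hyps(2) Suc.prems by simp
qed

section \<open>Reduction to normal words\<close>

text \<open>
  Moving \<open>\<partial>\<^sub>w\<close> past the coefficients of the Euler field \<open>\<Sum>\<^sub>h \<sigma>\<^sub>h \<partial>\<^sub>h\<close>: each letter \<open>p\<close> of \<open>w\<close>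
  contributes one commutator \<open>[\<partial>\<^sub>p, \<sigma>\<^sub>p] \<partial>\<^sub>p = \<partial>\<^sub>p\<close>, which restores the word \<open>w\<close>.
\<close>

lemma word_pd_euler:
  assumes W: "open W" "holo_on F W" and w: "letters CARD('n) w"
  shows "x \<in> W \<Longrightarrow> word_pd e w (\<lambda>\<sigma>. \<Sum>h=1..CARD('n). \<sigma> $ e h * pd (e h) F \<sigma>) x
    = (\<Sum>h=1..CARD('n). x $ e h * word_pd e w (pd (e h) F) x) + of_nat (length w) * word_pd e w F x"
  using w
proof (induction w arbitrary: x)
  case (Cons p w)
  note holo = word_pd_holo[OF W(1)] pd_holo(1)[OF W]
  have p: "p \<in> {1..CARD('n)}" using Cons.prems by simp
  have h1: "holo_on (\<lambda>\<sigma>. \<Sum>h=1..CARD('n). \<sigma> $ e h * word_pd e w (pd (e h) F) \<sigma>) W"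
    by (intro holo_on_sum holo_on_mult holo_on_coord holo)
  have h2: "holo_on (\<lambda>\<sigma>. of_nat (length w) * word_pd e w F \<sigma>) W"
    by (intro holo_on_mult holo_on_const holo W(2))
  have "word_pd e (p # w) (\<lambda>\<sigma>. \<Sum>h=1..CARD('n). \<sigma> $ e h * pd (e h) F \<sigma>) x
      = pd (e p) (\<lambda>\<sigma>. (\<Sum>h=1..CARD('n). \<sigma> $ e h * word_pd e w (pd (e h) F) \<sigma>)
          + of_nat (length w) * word_pd e w F \<sigma>) x"
    unfolding word_pd.simps by (intro pd_cong[of W] W Cons) (use Cons.prems in auto)
  also have "\<dots> = pd (e p) (\<lambda>\<sigma>. \<Sum>h=1..CARD('n). \<sigma> $ e h * word_pd e w (pd (e h) F) \<sigma>) x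
      + pd (e p) (\<lambda>\<sigma>. of_nat (length w) * word_pd e w F \<sigma>) x"
    by (rule pd_add[OF h1 h2 Cons.prems(1)])
  also have "pd (e p) (\<lambda>\<sigma>. of_nat (length w) * word_pd e w F \<sigma>) x
      = of_nat (length w) * word_pd e (p # w) F x"
    by (simp add: pd_cmult[OF holo(1)[OF W(2)] Cons.prems(1)])
  also have "pd (e p) (\<lambda>\<sigma>. \<Sum>h=1..CARD('n). \<sigma> $ e h * word_pd e w (pd (e h) F) \<sigma>) x
      = (\<Sum>h=1..CARD('n). pd (e p) (\<lambda>\<sigma>. \<sigma> $ e h * word_pd e w (pd (e h) F) \<sigma>) x)"
    by (intro pd_sum[OF _ Cons.prems(1)] holo_on_mult holo_on_coord holo)
  also have "\<dots> = (\<Sum>h=1..CARD('n). (if p = h then word_pd e w (pd (e h) F) x else 0)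
      + x $ e h * word_pd e (p # w) (pd (e h) F) x)"
  proof (rule sum.cong)
    fix h assume h: "h \<in> {1..CARD('n)}"
    show "pd (e p) (\<lambda>\<sigma>. \<sigma> $ e h * word_pd e w (pd (e h) F) \<sigma>) x
      = (if p = h then word_pd e w (pd (e h) F) x else 0) + x $ e h * word_pd e (p # w) (pd (e h) F) x"
      using e_eq_iff[OF p h]
      by (simp add: pd_mult[OF holo_on_coord holo(1)[OF holo(2)] Cons.prems(1)] pd_coord)
  qed simp
  also have "\<dots> = word_pd e w (pd (e p) F) x + (\<Sum>h=1..CARD('n). x $ e h * word_pd e (p # w) (pd (e h) F) x)"
    using p by (simp add: sum.distrib sum.delta)
  also have "word_pd e w (pd (e p) F) x = word_pd e (p # w) F x"
    using pd_word_pd_commute[OF W Cons.prems(1)] by simp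
  finally show ?case by (simp add: algebra_simps)
qed simp

text \<open>
  This is the product of \<open>\<partial>\<^sub>w\<close> with the generator \<open>T_op e m\<close>.  The term \<open>w @ [1, m - 1]\<close> has
  coefficient \<open>1\<close> and the least weight among the terms of maximal order, so the relation can be
  solved for it without dividing by a function.
\<close>

lemma in_ideal_T_op:
  assumes w: "letters CARD('n) w" and m: "m \<in> {2..CARD('n)}"
  shows "in_ideal V (\<lambda>f x. word_pd e (w @ [1, m - 1]) f x
    + (\<Sum>h=1..CARD('n). x $ e h * word_pd e (w @ [h, m]) f x)
    + of_nat (Suc (length w)) * word_pd e (w @ [m]) f x)"
proof -
  have "T_op e m \<in> J_generators e" using m unfolding J_generators_def by blast
  from in_ideal_generator[OF this w]
  show ?thesis
  proof (rule in_ideal_cong, unfold op_eq_def, intro allI impI ballI)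
    fix W and f :: "complex ^ 'n \<Rightarrow> complex" and x assume W: "open W" "holo_on f W" "x \<in> W"
    note holo = pd_holo(1)[OF W(1)]
    let ?E = "\<lambda>\<sigma>. \<Sum>h=1..CARD('n). \<sigma> $ e h * pd (e h) (pd (e m) f) \<sigma>"
    have hE: "holo_on ?E W"
      by (intro holo_on_sum holo_on_mult holo_on_coord holo W)
    have "word_pd e w (T_op e m f) x
        = word_pd e w (\<lambda>\<sigma>. (pd (e 1) (pd (e (m - 1)) f) \<sigma> + ?E \<sigma>) + pd (e m) f \<sigma>) x"
      by (rule word_pd_cong[OF W(1) _ W(3)]) (simp only: T_op_def)
    also have "\<dots> = word_pd e w (\<lambda>\<sigma>. pd (e 1) (pd (e (m - 1)) f) \<sigma> + ?E \<sigma>) x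
        + word_pd e w (pd (e m) f) x"
      by (intro word_pd_add[OF W(1) _ _ W(3)] holo_on_add hE holo W)
    also have "word_pd e w (\<lambda>\<sigma>. pd (e 1) (pd (e (m - 1)) f) \<sigma> + ?E \<sigma>) x
        = word_pd e w (pd (e 1) (pd (e (m - 1)) f)) x + word_pd e w ?E x"
      by (intro word_pd_add[OF W(1) _ _ W(3)] hE holo W)
    also have "word_pd e w ?E x = (\<Sum>h=1..CARD('n). x $ e h * word_pd e w (pd (e h) (pd (e m) f)) x)
        + of_nat (length w) * word_pd e w (pd (e m) f) x"
      by (rule word_pd_euler[OF W(1) holo[OF W(2)] w W(3)])
    finally show "word_pd e (w @ [1, m - 1]) f x
        + (\<Sum>h=1..CARD('n). x $ e h * word_pd e (w @ [h, m]) f x)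
        + of_nat (Suc (length w)) * word_pd e (w @ [m]) f x = word_pd e w (T_op e m f) x"
      by (simp add: word_pd_append algebra_simps)
  qed
qed

end

text \<open>
  The weights of the words of order \<open>r\<close> that survive the reduction are \<open>(r - 1) k + 1, \<dots>, r k\<close>.
  For \<open>r = 1, 2, \<dots>\<close> these intervals tile the positive integers, so the weight alone indexes the
  normal forms: \<open>normal_word k n\<close> has weight \<open>n\<close> and order \<open>\<lceil>n / k\<rceil>\<close>.  Weight \<open>0\<close> stands for the
  identity operator.
\<close>

definition normal_word :: "nat \<Rightarrow> nat \<Rightarrow> nat list" where
  "normal_word k n = (if n = 0 then [] else Suc ((n - 1) mod k) # replicate ((n - 1) div k) k)"

context labelled_coords begin

lemma letters_normal_word: "letters CARD('n) (normal_word CARD('n) n)"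
  by (auto simp: normal_word_def Suc_leI)

lemma sum_list_normal_word: "sum_list (normal_word CARD('n) n) = n"
  by (simp add: normal_word_def sum_list_replicate)

lemma length_normal_word: "n > 0 \<Longrightarrow> length (normal_word CARD('n) n) = Suc ((n - 1) div CARD('n))"
  by (simp add: normal_word_def)

text \<open>
  Congruence modulo the ideal to a combination of normal words with holomorphic coefficients.
\<close>

definition reducible :: "(complex ^ 'n) set \<Rightarrow> 'n oper \<Rightarrow> bool" where
  "reducible V T \<longleftrightarrow> (\<exists>D b. (\<forall>n. holo_on (b n) V) \<and>
     in_ideal V (\<lambda>f x. T f x - (\<Sum>n\<le>D. b n x * word_pd e (normal_word CARD('n) n) f x)))"

lemma reducible_normal_word: "reducible V (word_pd e (normal_word CARD('n) n))"
  unfolding reducible_def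
proof (rule exI[of _ n], rule exI[of _ "\<lambda>i x. if i = n then 1 else 0"], intro conjI allI)
  show "holo_on (\<lambda>x. if i = n then 1 else 0) V" for i by (simp add: holo_on_const)
  show "in_ideal V (\<lambda>f x. word_pd e (normal_word CARD('n) n) f x
      - (\<Sum>i\<le>n. (if i = n then 1 else 0) * word_pd e (normal_word CARD('n) i) f x))"
    by (rule in_ideal_cong[OF in_ideal_zero])
       (simp add: op_eq_def if_distrib[of "\<lambda>z. z * _"] sum.delta cong: if_cong)
qed

lemma reducible_mod:
  assumes "in_ideal V (\<lambda>f x. S f x - T f x)" "reducible V T"
  shows "reducible V S"
proof -
  obtain D b where b: "\<And>n. holo_on (b n) V"
    "in_ideal V (\<lambda>f x. T f x - (\<Sum>n\<le>D. b n x * word_pd e (normal_word CARD('n) n) f x))"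
    using assms(2) unfolding reducible_def by blast
  have "in_ideal V (\<lambda>f x. S f x - (\<Sum>n\<le>D. b n x * word_pd e (normal_word CARD('n) n) f x))"
    using in_ideal_add[OF assms(1) b(2)] by simp
  then show ?thesis unfolding reducible_def using b(1) by blast
qed

lemma reducible_cong: "op_eq V S T \<Longrightarrow> reducible V T \<Longrightarrow> reducible V S"
  by (rule reducible_mod[OF in_ideal_cong[OF in_ideal_zero]]) (auto simp: op_eq_def)

lemma reducible_smult:
  assumes "reducible V T" "holo_on c V"
  shows "reducible V (\<lambda>f x. c x * T f x)"
proof -
  obtain D b where b: "\<And>n. holo_on (b n) V"
    "in_ideal V (\<lambda>f x. T f x - (\<Sum>n\<le>D. b n x * word_pd e (normal_word CARD('n) n) f x))"
    using assms(1) unfolding reducible_def by blast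
  have "in_ideal V (\<lambda>f x. c x * T f x - (\<Sum>n\<le>D. (c x * b n x) * word_pd e (normal_word CARD('n) n) f x))"
    using in_ideal_smult[OF b(2) assms(2)] by (simp add: right_diff_distrib sum_distrib_left mult.assoc)
  then show ?thesis
    unfolding reducible_def
    by (intro exI[of _ D] exI[of _ "\<lambda>n x. c x * b n x"]) (auto intro: holo_on_mult b(1) assms(2))
qed

lemma reducible_add:
  assumes "reducible V S" "reducible V T"
  shows "reducible V (\<lambda>f x. S f x + T f x)"
proof -
  obtain D1 b1 where b1: "\<And>n. holo_on (b1 n) V"
    "in_ideal V (\<lambda>f x. S f x - (\<Sum>n\<le>D1. b1 n x * word_pd e (normal_word CARD('n) n) f x))"
    using assms(1) unfolding reducible_def by blast
  obtain D2 b2 where b2: "\<And>n. holo_on (b2 n) V"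
    "in_ideal V (\<lambda>f x. T f x - (\<Sum>n\<le>D2. b2 n x * word_pd e (normal_word CARD('n) n) f x))"
    using assms(2) unfolding reducible_def by blast
  define D where "D = max D1 D2"
  define b where "b = (\<lambda>n x. (if n \<le> D1 then b1 n x else 0) + (if n \<le> D2 then b2 n x else 0))"
  have cut: "(\<Sum>n\<le>D. (if n \<le> d then c n else 0) * g n) = (\<Sum>n\<le>d. c n * g n)"
    if "d \<le> D" for d and c g :: "nat \<Rightarrow> complex"
    by (rule sum.mono_neutral_cong_right) (use that in auto)
  have le: "D1 \<le> D" "D2 \<le> D" by (simp_all add: D_def)
  have eq: "(\<Sum>n\<le>D. b n x * g n) = (\<Sum>n\<le>D1. b1 n x * g n) + (\<Sum>n\<le>D2. b2 n x * g n)" for x g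
    by (simp add: b_def distrib_right sum.distrib cut le)
  have "holo_on (b n) V" for n
    unfolding b_def by (cases "n \<le> D1"; cases "n \<le> D2") (simp_all add: b1(1) b2(1) holo_on_add holo_on_const)
  moreover have "in_ideal V (\<lambda>f x. S f x + T f x - (\<Sum>n\<le>D. b n x * word_pd e (normal_word CARD('n) n) f x))"
    using in_ideal_add[OF b1(2) b2(2)] unfolding eq by (simp add: algebra_simps)
  ultimately show ?thesis unfolding reducible_def by blast
qed

lemma reducible_zero: "reducible V (\<lambda>f x. 0)"
  using reducible_smult[OF reducible_normal_word holo_on_const, of V 0 0] by simp

lemma reducible_sum:
  "finite A \<Longrightarrow> (\<And>i. i \<in> A \<Longrightarrow> reducible V (T i)) \<Longrightarrow> reducible V (\<lambda>f x. \<Sum>i\<in>A. T i f x)"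
  by (induction A rule: finite_induct) (simp_all add: reducible_zero reducible_add)

lemma exists_word:
  assumes "r \<le> s" "s \<le> r * CARD('n)"
  shows "\<exists>w. letters CARD('n) w \<and> length w = r \<and> sum_list w = s"
  using assms
proof (induction r arbitrary: s)
  case (Suc r)
  define a where "a = min (CARD('n)) (s - r)"
  have "r \<le> s - a" "s - a \<le> r * CARD('n)" "a \<in> {1..CARD('n)}" "a \<le> s"
    using Suc.prems mult_le_mono2[of 1 "CARD('n)" r] by (auto simp: a_def min_def Suc_leI)
  moreover from Suc.IH[OF this(1,2)] obtain w where "letters CARD('n) w" "length w = r" "sum_list w = s - a"
    by blast
  ultimately show ?case by (intro exI[of _ "a # w"]) auto
qed simp

lemma word_equiv_reducible: "word_equiv V u v \<Longrightarrow> reducible V (word_pd e v) \<Longrightarrow> reducible V (word_pd e u)"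
  by (rule reducible_mod) (auto simp: word_equiv_def dest: spec[of _ "[]"])

text \<open>
  A word of order \<open>r\<close> and weight \<open>s > (r - 1) k\<close> is equivalent to \<open>normal_word k s\<close>.  If
  \<open>s \<le> (r - 1) k\<close>, then \<open>r \<ge> 2\<close> and the word is equivalent to one of the form \<open>c @ [1, m - 1]\<close>;
  the generator with index \<open>m\<close> rewrites it by words of the same order and larger weight and by a
  word of smaller order.  The weight is at most \<open>r k\<close>, so this terminates.
\<close>

lemma reducible_word_pd: "letters CARD('n) w \<Longrightarrow> reducible V (word_pd e w)"
proof (induction w rule: wf_induct_rule[OF wf_measures[of "[length, \<lambda>w. length w * CARD('n) - sum_list w]"]])
  case (1 w)
  let ?k = "CARD('n)"
  define r where "r = length w"
  define s where "s = sum_list w"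
  have rs: "r \<le> s" "s \<le> r * ?k"
    using length_le_sum_list[OF 1(2)] sum_list_le[OF 1(2)] by (auto simp: r_def s_def)
  consider "r = 0" | "r > 0" "s > (r - 1) * ?k" | "r > 0" "s \<le> (r - 1) * ?k" by linarith
  then show ?case
  proof cases
    case 1
    then have "w = normal_word CARD('n) 0" by (simp add: r_def normal_word_def)
    then show ?thesis by (simp only: reducible_normal_word)
  next
    case 2
    have "(s - 1) div ?k = r - 1"
      using 2 rs by (intro div_nat_eqI) (auto simp: algebra_simps diff_mult_distrib)
    then have "length w = length (normal_word CARD('n) s)"
      using 2 rs by (simp add: length_normal_word r_def)
    then have "word_equiv V w (normal_word CARD('n) s)"
      using "1.prems" by (intro word_equiv_same_weight letters_normal_word) (simp_all add: sum_list_normal_word s_def)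
    then show ?thesis by (rule word_equiv_reducible) (rule reducible_normal_word)
  next
    case 3
    have k2: "2 \<le> ?k" "2 \<le> r"
    proof -
      have "(r - 1) * ?k > r - 1" using 3 rs by linarith
      then have "?k \<noteq> 1" "r - 1 \<noteq> 0" by (auto intro!: notI)
      moreover have "?k > 0" by simp
      ultimately show "2 \<le> ?k" "2 \<le> r" by linarith+
    qed
    \<comment> \<open>The prefix \<open>c\<close> of length \<open>r - 2\<close> must have weight \<open>s - m\<close> between \<open>r - 2\<close> and \<open>t\<close>;
      this is the smallest \<open>m \<ge> 2\<close> for which that weight is at most \<open>t\<close>.\<close>
    define t where "t = (r - 2) * ?k"
    define m where "m = max 2 (s - t)"
    have split: "(r - 1) * ?k = t + ?k"
    proof -
      have "r - 1 = Suc (r - 2)" using k2 by simp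
      then show ?thesis by (simp add: t_def)
    qed
    have m: "m \<in> {2..?k}" using 3 k2 split by (auto simp: m_def)
    have "r - 2 \<le> t" by (simp add: t_def)
    then have "r - 2 \<le> s - m" "s - m \<le> t" "m \<le> s"
      using rs k2 by (auto simp: m_def max_def)
    then obtain c where c: "letters CARD('n) c" "length c = r - 2" "sum_list c + m = s"
      using exists_word[of "r - 2" "s - m"] by (auto simp: t_def)
    have "word_equiv V w (c @ [1, m - 1])"
      using "1.prems" m c k2 by (intro word_equiv_same_weight) (auto simp: r_def[symmetric] s_def[symmetric])
    then show ?thesis
    proof (rule word_equiv_reducible)
      let ?T = "\<lambda>f x. (\<Sum>h=1..?k. (- x $ e h) * word_pd e (c @ [h, m]) f x)
          + (- of_nat (Suc (length c))) * word_pd e (c @ [m]) f x"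
      have "reducible V (word_pd e (c @ [h, m]))" if h: "h \<in> {1..?k}" for h
      proof (rule "1.IH")
        have "(r - 1) * ?k < r * ?k" using k2 by simp
        with 3 have "s < r * ?k" by linarith
        with h have "r * ?k - (s + h) < r * ?k - s" by (intro diff_less_mono2) auto
        moreover have "length (c @ [h, m]) = r" "sum_list (c @ [h, m]) = s + h"
          using c k2 by auto
        ultimately have "length (c @ [h, m]) = length w"
          "length (c @ [h, m]) * ?k - sum_list (c @ [h, m]) < length w * ?k - sum_list w"
          by (simp_all only: r_def s_def)
        then show "(c @ [h, m], w) \<in> measures [length, \<lambda>w. length w * ?k - sum_list w]"
          by simp
      qed (use c m h in auto)
      moreover have "reducible V (word_pd e (c @ [m]))"
        by (rule "1.IH") (use c m k2 in \<open>auto simp: r_def[symmetric]\<close>)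
      moreover have "holo_on (\<lambda>x. - x $ e h) V" for h
        using holo_on_mult[OF holo_on_const holo_on_coord, of "- 1" "e h" V] by simp
      ultimately have "reducible V ?T"
        by (intro reducible_add reducible_sum reducible_smult holo_on_const) auto
      then show "reducible V (word_pd e (c @ [1, m - 1]))"
        by (rule reducible_mod[rotated], intro in_ideal_cong[OF in_ideal_T_op[OF c(1) m]])
           (simp add: op_eq_def sum_negf algebra_simps)
    qed
  qed
qed

section \<open>Operators annihilating the Newton polynomials\<close>

text \<open>
  Exchange operators compare two words of equal length and weight.  For the other generators the
  closed formula turns the claim into \<open>E G\<^sup>2 - G = 0\<close>, with the terms of \<open>E\<close> coming from the
  coefficients \<open>\<sigma>\<^sub>h\<close> of the Euler field.
\<close>

lemma generator_newton:
  assumes "g \<in> J_generators e"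
  shows "g (newton e m) = (\<lambda>x. 0)"
proof
  fix x
  consider p q i where "g = exchange_op e p q i" "{p, q, p + i, q - i} \<subseteq> {1..int CARD('n)}"
    | l where "g = T_op e l" "l \<in> {2..CARD('n)}"
    using assms unfolding J_generators_def by blast
  then show "g (newton e m) x = 0"
  proof cases
    case 1
    have "exchange_op e p q i (newton e m) x
        = word_pd e [nat p, nat q] (newton e m) x - word_pd e [nat (p + i), nat (q - i)] (newton e m) x"
      by (simp add: exchange_op_def)
    also have "\<dots> = 0"
    proof -
      have "nat p + nat q = nat (p + i) + nat (q - i)" using 1(2) by (auto simp flip: nat_add_distrib)
      moreover have "letters CARD('n) [nat p, nat q]" "letters CARD('n) [nat (p + i), nat (q - i)]"
        using 1(2) by auto
      ultimately show ?thesis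
        using word_pd_newton[of "[nat p, nat q]" m x] word_pd_newton[of "[nat (p + i), nat (q - i)]" m x]
        by simp
    qed
    finally show ?thesis using 1 by simp
  next
    case 2
    define G where "G = inv_fps x"
    define c where "c = (- 1) ^ l * (of_nat m :: complex)"
    have "T_op e l (newton e m) x = word_pd e [1, l - 1] (newton e m) x
      + (\<Sum>h=1..CARD('n). x $ e h * word_pd e [h, l] (newton e m) x) + word_pd e [l] (newton e m) x"
      by (simp add: T_op_def)
    also have "word_pd e [1, l - 1] (newton e m) x = c * fps_nth (fps_X ^ l * G ^ 2) m"
    proof -
      have "letters CARD('n) [1, l - 1]" using 2 by auto
      then show ?thesis
        using 2 word_pd_newton[of "[1, l - 1]" m x] by (simp add: c_def G_def numeral_2_eq_2)
    qed
    also have "word_pd e [l] (newton e m) x = - c * fps_nth (fps_X ^ l * G) m"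
      using 2 word_pd_newton[of "[l]" m x] by (simp add: c_def G_def)
    also have "(\<Sum>h=1..CARD('n). x $ e h * word_pd e [h, l] (newton e m) x)
        = (\<Sum>h=1..CARD('n). c * fps_nth (fps_const ((- 1) ^ h * x $ e h) * fps_X ^ h * (fps_X ^ l * G ^ 2)) m)"
    proof (rule sum.cong)
      fix h assume "h \<in> {1..CARD('n)}"
      then have "word_pd e [h, l] (newton e m) x
          = (- 1) ^ (h + l) * of_nat m * fps_nth (fps_X ^ (h + l) * G ^ 2) m"
        using 2 word_pd_newton[of "[h, l]" m x] by (simp add: G_def numeral_2_eq_2)
      then show "x $ e h * word_pd e [h, l] (newton e m) x
          = c * fps_nth (fps_const ((- 1) ^ h * x $ e h) * fps_X ^ h * (fps_X ^ l * G ^ 2)) m"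
        by (simp add: c_def power_add mult.assoc)
    qed simp
    also have "\<dots> = c * fps_nth ((\<Sum>h=1..CARD('n). fps_const ((- 1) ^ h * x $ e h) * fps_X ^ h) * (fps_X ^ l * G ^ 2)) m"
      by (simp add: sum_distrib_right sum_distrib_left fps_sum_nth)
    also have "(\<Sum>h=1..CARD('n). fps_const ((- 1) ^ h * x $ e h) * fps_X ^ h) = char_fps x - 1"
    proof (rule fps_ext)
      fix n
      have "fps_nth (\<Sum>h=1..CARD('n). fps_const ((- 1) ^ h * x $ e h) * fps_X ^ h) n
          = (\<Sum>h=1..CARD('n). if h = n then (- 1) ^ h * x $ e h else 0)"
        unfolding fps_sum_nth by (intro sum.cong) (auto simp: fps_X_power_iff)
      then show "fps_nth (\<Sum>h=1..CARD('n). fps_const ((- 1) ^ h * x $ e h) * fps_X ^ h) n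
          = fps_nth (char_fps x - 1) n"
        by (simp add: char_fps_def sum.delta)
    qed
    also have "(char_fps x - 1) * (fps_X ^ l * G ^ 2)
        = fps_X ^ l * G * (char_fps x * G) - fps_X ^ l * G ^ 2"
      by (simp add: algebra_simps power2_eq_square)
    also have "char_fps x * G = 1" by (simp add: G_def char_inv)
    finally show ?thesis using 2 by (simp add: algebra_simps)
  qed
qed

lemma in_ideal_newton:
  assumes "open V" "in_ideal V T" "x \<in> V"
  shows "T (newton e m) x = 0"
proof -
  obtain Q where Q: "\<And>g. g \<in> J_generators e \<Longrightarrow> finite_order_on e V (Q g)"
    "op_eq V T (\<lambda>f x. \<Sum>g\<in>J_generators e. Q g (g f) x)"
    using assms(2) unfolding in_ideal_def by blast
  have "T (newton e m) x = (\<Sum>g\<in>J_generators e. Q g (g (newton e m)) x)"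
    using Q(2) assms holo_newton[of m V] unfolding op_eq_def by blast
  also have "\<dots> = 0"
  proof (rule sum.neutral, rule ballI)
    fix g assume g: "g \<in> J_generators e"
    obtain d a where "op_eq V (Q g) (\<lambda>f x. \<Sum>\<alpha> | (\<Sum>j\<in>UNIV. \<alpha> j) \<le> (d::nat). a \<alpha> x * multi_pd e \<alpha> f x)"
      using Q(1)[OF g] unfolding finite_order_on_def by blast
    then have "Q g (\<lambda>x. 0) x = (\<Sum>\<alpha> | (\<Sum>j\<in>UNIV. \<alpha> j) \<le> d. a \<alpha> x * multi_pd e \<alpha> (\<lambda>x. 0) x)"
      using assms holo_on_const[of 0 V] unfolding op_eq_def by blast
    then show "Q g (g (newton e m)) x = 0"
      by (simp add: generator_newton[OF g] multi_pd_eq_word_pd word_pd_zero)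
  qed
  finally show ?thesis .
qed

text \<open>
  \<open>\<partial>\<^sub>w N\<^sub>m\<close> is a multiple of the coefficient of \<open>t\<^sup>m\<close> in \<open>t\<^sup>n G\<^sup>r\<close>, where \<open>n\<close> is the weight of \<open>w\<close> and \<open>G\<close>
  has constant term \<open>1\<close>.  So the matrix of values of the normal words on the Newton polynomials is
  triangular with non-zero diagonal.  In weight \<open>0\<close> the diagonal entry is \<open>N\<^sub>0 = k\<close>.
\<close>

lemma normal_word_newton_less:
  assumes "m < n"
  shows "word_pd e (normal_word CARD('n) n) (newton e m) x = 0"
proof -
  have "normal_word CARD('n) n \<noteq> []" using assms by (simp add: normal_word_def)
  then show ?thesis
    using assms by (simp add: word_pd_newton[OF _ letters_normal_word] sum_list_normal_word fps_X_power_mult_nth)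
qed

lemma normal_word_newton_eq: "word_pd e (normal_word CARD('n) n) (newton e n) x \<noteq> 0"
proof (cases "n = 0")
  case True
  then show ?thesis by (simp add: normal_word_def newton_def size_proots_P_poly)
next
  case False
  then have "normal_word CARD('n) n \<noteq> []" by (simp add: normal_word_def)
  moreover have "fps_nth (inv_fps x ^ r) 0 = 1" for r by (simp add: fps_power_zeroth inv_fps_0)
  ultimately show ?thesis
    using False by (simp add: word_pd_newton[OF _ letters_normal_word] sum_list_normal_word fps_X_power_mult_nth)
qed

text \<open>
  Elements of the ideal annihilate every \<open>N\<^sub>m\<close>, so the normal form of \<open>T\<close> does as well, and by
  triangularity its coefficients vanish at every point of \<open>V\<close>.
\<close>

lemma in_ideal_if_kills_newton:
  assumes V: "open V" and T: "finite_order_on e V T"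
    and kill: "\<And>m x. x \<in> V \<Longrightarrow> T (newton e m) x = 0"
  shows "in_ideal V T"
proof -
  obtain d a where a: "\<And>\<alpha>. holo_on (a \<alpha>) V"
    "op_eq V T (\<lambda>f x. \<Sum>\<alpha> | (\<Sum>j\<in>UNIV. \<alpha> j) \<le> (d::nat). a \<alpha> x * multi_pd e \<alpha> f x)"
    using T unfolding finite_order_on_def by blast
  have "reducible V (multi_pd e \<alpha>)" for \<alpha>
    unfolding multi_pd_eq_word_pd by (rule reducible_word_pd) auto
  then have "reducible V T"
    by (intro reducible_cong[OF a(2)] reducible_sum reducible_smult a(1) finite_multi_indices)
  then obtain D b where b: "\<And>n. holo_on (b n) V"
    "in_ideal V (\<lambda>f x. T f x - (\<Sum>n\<le>D. b n x * word_pd e (normal_word CARD('n) n) f x))"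
    unfolding reducible_def by blast
  have b0: "b n x = 0" if x: "x \<in> V" and "n \<le> D" for n x
    using \<open>n \<le> D\<close>
  proof (induction n rule: less_induct)
    case (less n)
    have "0 = (\<Sum>i\<le>D. b i x * word_pd e (normal_word CARD('n) i) (newton e n) x)"
      using in_ideal_newton[OF V b(2) x, of n] kill[OF x, of n] by simp
    also have "\<dots> = (\<Sum>i\<in>{n}. b i x * word_pd e (normal_word CARD('n) i) (newton e n) x)"
    proof (rule sum.mono_neutral_right)
      show "\<forall>i\<in>{..D} - {n}. b i x * word_pd e (normal_word CARD('n) i) (newton e n) x = 0"
      proof
        fix i assume "i \<in> {..D} - {n}"
        then consider "i < n" | "n < i" by fastforce
        then show "b i x * word_pd e (normal_word CARD('n) i) (newton e n) x = 0"
          by cases (use less in \<open>auto simp: normal_word_newton_less\<close>)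
      qed
    qed (use less.prems in auto)
    finally show "b n x = 0" by (simp add: normal_word_newton_eq)
  qed
  from b(2) show ?thesis
    by (rule in_ideal_cong) (use b0 in \<open>auto simp: op_eq_def subset_iff\<close>)
qed

text \<open>
  Membership in the ideal sheaf is local, so it suffices to treat a neighbourhood of each point
  on which \<open>P\<close> has finite order.
\<close>

lemma in_J_sheaf:
  assumes "P \<in> diff_ops e UNIV" and "\<And>m \<sigma>. P (newton e m) \<sigma> = 0"
  shows "P \<in> J_sheaf e UNIV"
  unfolding J_sheaf_def ideal_sheaf_def
proof (intro CollectI conjI ballI)
  fix x :: "complex ^ 'n"
  obtain V where V: "open V" "x \<in> V" "finite_order_on e V P"
    using assms(1) unfolding diff_ops_def by blast
  have local: "finite_order_on e V T \<Longrightarrow> T \<in> diff_ops e V" for T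
    unfolding diff_ops_def using V(1) by blast
  have "in_ideal V P" by (rule in_ideal_if_kills_newton[OF V(1,3) assms(2)])
  then obtain Q where "\<forall>g\<in>J_generators e. finite_order_on e V (Q g)"
    "op_eq V P (\<lambda>f x. \<Sum>g\<in>J_generators e. Q g (g f) x)"
    unfolding in_ideal_def by blast
  then have "P \<in> left_ideal_gen e V (J_generators e)"
    unfolding left_ideal_gen_def using local V(3) finite_J_generators by blast
  then show "\<exists>V. open V \<and> x \<in> V \<and> V \<subseteq> UNIV \<and> P \<in> left_ideal_gen e V (J_generators e)"
    using V by blast
qed (rule assms(1))

end

theorem theorem5p1p1:
  fixes e :: "nat \<Rightarrow> 'n::finite"
    and P :: "'n oper"
  assumes "bij_betw e {1..CARD('n)} UNIV"
    and "P \<in> diff_ops e UNIV"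
    and "\<And>m \<sigma>. P (newton e m) \<sigma> = 0"
  shows "P \<in> J_sheaf e UNIV"
proof -
  interpret labelled_coords e by unfold_locales (rule assms(1))
  show ?thesis by (rule in_J_sheaf[OF assms(2,3)])
qed

end
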